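(* Let $m\ge3$ be an integer, written as $m=j2^k$ where either $j$ is odd with $j\ge3$ or $j=4$, and $k\ge0$ is an integer, and let $A\subseteq\{0,\dots,m-1\}$ be non-simple. Let $C$ be a class of two-party functions each having deterministic communication complexity at most $c$. Then any $\mathsf{THR}\circ C$ circuit computing $\mathrm{mod}_m^A\circ\mathsf{XOR}$ must have size \[s\ge2^{\Omega\left(\frac{n-km}{jm}\right)-\frac{2j\log j}{m}-c}.\]
   Context: For positive integer $m<n$ and $A\subseteq\{0,\dots,m-1\}$, $\mathrm{mod}_m^A:\{0,1\}^n\to\{-1,1\}$ is $-1$ if $\sum_ix_i\equiv a\pmod m$ for some $a\in A$ and $1$ otherwise; $A$ is simple if $\mathrm{mod}_m^A$ is constant, parity, or the negation of parity. $(\mathrm{mod}_m^A\circ\mathsf{XOR})(x,y)=\mathrm{mod}_m^A(x\oplus y)$ on $x,y\in\{0,1\}^n$, with $x$ given to Alice and $y$ to Bob. A $\mathsf{THR}\circ C$ circuit of size $s$ is a single linear threshold gate (sign of a real weighted sum) applied to the outputs of $s$ gates, each computing a function of $(x,y)$ from $C$. *)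

theory Defs
  imports Complex_Main "HOL-Library.FuncSet" "HOL-Number_Theory.Cong"
begin

section \<open>Bit strings, modular functions and parity\<close>

definition cube :: "nat \<Rightarrow> bool list set" where
  "cube n = {x. length x = n}"

definition bit_sum :: "bool list \<Rightarrow> nat" where
  "bit_sum x = (\<Sum>i<length x. of_bool (x ! i))"

definition mod_fn :: "nat \<Rightarrow> nat set \<Rightarrow> bool list \<Rightarrow> real" where
  "mod_fn m A x = (if \<exists>a\<in>A. [bit_sum x = a] (mod m) then -1 else 1)"

definition parity :: "bool list \<Rightarrow> real" where
  "parity x = (-1) ^ bit_sum x"

definition simple :: "nat \<Rightarrow> nat \<Rightarrow> nat set \<Rightarrow> bool" where
  "simple n m A \<longleftrightarrow>
     (\<exists>v. \<forall>x\<in>cube n. mod_fn m A x = v) \<or>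
     (\<forall>x\<in>cube n. mod_fn m A x = parity x) \<or>
     (\<forall>x\<in>cube n. mod_fn m A x = - parity x)"

section \<open>Two-party functions and deterministic communication complexity\<close>

type_synonym two_party = "bool list \<Rightarrow> bool list \<Rightarrow> real"

definition two_party_fns :: "nat \<Rightarrow> two_party set" where
  "two_party_fns n = cube n \<rightarrow> (cube n \<rightarrow> {-1, 1})"

definition compose_xor :: "(bool list \<Rightarrow> real) \<Rightarrow> two_party" where
  "compose_xor f x y = f (map2 (\<noteq>) x y)"

text \<open>Protocol trees: at an inner node the named player sends one bit, computed from that
  player's own input; the leaves carry the value on which both players agree.\<close>

datatype protocol =
    Leaf real
  | Alice "bool list \<Rightarrow> bool" protocol protocol
  | Bob "bool list \<Rightarrow> bool" protocol protocol

primrec run :: "protocol \<Rightarrow> two_party" where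
  "run (Leaf v) x y = v"
| "run (Alice q P Q) x y = (if q x then run P x y else run Q x y)"
| "run (Bob q P Q) x y = (if q y then run P x y else run Q x y)"

primrec cost :: "protocol \<Rightarrow> nat" where
  "cost (Leaf v) = 0"
| "cost (Alice q P Q) = Suc (max (cost P) (cost Q))"
| "cost (Bob q P Q) = Suc (max (cost P) (cost Q))"

definition protocol_computes :: "nat \<Rightarrow> protocol \<Rightarrow> two_party \<Rightarrow> bool" where
  "protocol_computes n P f \<longleftrightarrow> (\<forall>x\<in>cube n. \<forall>y\<in>cube n. run P x y = f x y)"

definition det_cc :: "nat \<Rightarrow> two_party \<Rightarrow> nat" where
  "det_cc n f = (LEAST d. \<exists>P. protocol_computes n P f \<and> cost P = d)"

text \<open>The set in the definition of \<^const>\<open>det_cc\<close> is never empty, so the minimum is attained.\<close>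

lemma protocol_exists: "\<exists>P. protocol_computes n P f"
proof -
  have partial: "\<exists>P. \<forall>p\<in>S. run P (fst p) (snd p) = f (fst p) (snd p)" if "finite S" for S
    using that
  proof (induction S rule: finite_psubset_induct)
    case (psubset S)
    show ?case
    proof (cases "\<exists>p\<in>S. \<exists>q\<in>S. p \<noteq> q")
      case False
      then have "\<exists>v. \<forall>p\<in>S. v = f (fst p) (snd p)" by metis
      then obtain v where "\<forall>p\<in>S. v = f (fst p) (snd p)" ..
      then have "\<forall>p\<in>S. run (Leaf v) (fst p) (snd p) = f (fst p) (snd p)" by simp
      then show ?thesis by (rule exI)
    next
      case True
      then obtain p q where pq: "p \<in> S" "q \<in> S" "p \<noteq> q" by blast
      show ?thesis
      proof (cases "fst p = fst q")
        case False
        let ?T = "{r \<in> S. fst r = fst p}" and ?U = "{r \<in> S. fst r \<noteq> fst p}"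
        have "q \<in> S - ?T" "p \<in> S - ?U" using pq False by simp_all
        then have "?T \<subset> S" "?U \<subset> S" by blast+
        from psubset.IH[OF this(1)] psubset.IH[OF this(2)] obtain P Q where
          "\<forall>r\<in>?T. run P (fst r) (snd r) = f (fst r) (snd r)"
          "\<forall>r\<in>?U. run Q (fst r) (snd r) = f (fst r) (snd r)" by (elim exE) (rule that)
        then have "\<forall>r\<in>S. run (Alice (\<lambda>x. x = fst p) P Q) (fst r) (snd r) = f (fst r) (snd r)"
          by (auto simp del: split_paired_All)
        then show ?thesis by (rule exI)
      next
        case True
        with pq have ne: "snd p \<noteq> snd q" by (simp add: prod_eq_iff)
        let ?T = "{r \<in> S. snd r = snd p}" and ?U = "{r \<in> S. snd r \<noteq> snd p}"
        have "q \<in> S - ?T" "p \<in> S - ?U" using pq ne by simp_all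
        then have "?T \<subset> S" "?U \<subset> S" by blast+
        from psubset.IH[OF this(1)] psubset.IH[OF this(2)] obtain P Q where
          "\<forall>r\<in>?T. run P (fst r) (snd r) = f (fst r) (snd r)"
          "\<forall>r\<in>?U. run Q (fst r) (snd r) = f (fst r) (snd r)" by (elim exE) (rule that)
        then have "\<forall>r\<in>S. run (Bob (\<lambda>y. y = snd p) P Q) (fst r) (snd r) = f (fst r) (snd r)"
          by (auto simp del: split_paired_All)
        then show ?thesis by (rule exI)
      qed
    qed
  qed
  have "finite (cube n)"
    using finite_lists_length_eq[of "UNIV :: bool set" n] by (simp add: cube_def)
  then show ?thesis
    using partial[of "cube n \<times> cube n"] by (simp add: protocol_computes_def)
qed

lemma det_cc_attained: "\<exists>P. protocol_computes n P f \<and> cost P = det_cc n f"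
  unfolding det_cc_def by (rule LeastI_ex) (use protocol_exists in blast)

section \<open>Threshold circuits\<close>

text \<open>\<open>THR b gs\<close> is the sign of \<open>b + (\<Sum>(w, g) \<leftarrow> gs. w * g x y)\<close>. The bias \<open>b\<close> is not counted in
  the size; \<open>b = 0\<close> gives the gate without a threshold. The value of the sign at 0 is
  immaterial: there are finitely many inputs, so a small change of \<open>b\<close> makes every sum nonzero.\<close>

datatype thr_circuit = THR real "(real \<times> two_party) list"

primrec circuit_eval :: "thr_circuit \<Rightarrow> two_party" where
  "circuit_eval (THR b gs) x y = (if b + (\<Sum>(w, g)\<leftarrow>gs. w * g x y) \<ge> 0 then 1 else -1)"

primrec circuit_size :: "thr_circuit \<Rightarrow> nat" where
  "circuit_size (THR b gs) = length gs"

primrec circuit_gates :: "thr_circuit \<Rightarrow> two_party set" where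
  "circuit_gates (THR b gs) = snd ` set gs"

definition circuit_computes :: "nat \<Rightarrow> thr_circuit \<Rightarrow> two_party \<Rightarrow> bool" where
  "circuit_computes n T F \<longleftrightarrow> (\<forall>x\<in>cube n. \<forall>y\<in>cube n. circuit_eval T x y = F x y)"

end

theory Submission
  imports Defs "HOL-Analysis.Convex"
begin

text \<open>A gate of communication complexity at most \<open>c\<close> is a matrix of rank at most \<open>2 ^ c\<close>, so a circuit
  of size \<open>s\<close> bounds the sign rank of the composed function by \<open>s * 2 ^ c + 1\<close>.

  For the lower bound, let \<open>f\<close> be the value as a function of the Hamming weight. A non-simple \<open>f\<close> has
  least period at least 3, hence there are a prime \<open>q \<le> j\<close> and \<open>e\<close>, \<open>D\<close> with \<open>D * q \<le> m\<close> such that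
  \<open>t \<mapsto> f (e + 2 * D * t)\<close> is non-constant and \<open>q\<close>-periodic. Repeating bits, one encodes
  \<open>z, w \<in> {0..<q}\<^sup>L\<close> by inputs whose XOR has weight \<open>e + 2 * D * (const - \<langle>z, w\<rangle>)\<close>, where \<open>L\<close> is of order
  \<open>n / (j * m)\<close>. So the composed function contains the matrix \<open>h \<langle>z, w\<rangle>\<close> with \<open>h\<close> non-constant modulo \<open>q\<close>.
  Weighting its signs to mean 0 makes the rows with \<open>z 0 = 1\<close> pairwise orthogonal, and
  Forster's theorem bounds the sign rank from below by a power of \<open>q\<close> with exponent about \<open>L / 2\<close>.\<close>

section \<open>Sign rank and orthogonal rows\<close>

text \<open>Vectors of dimension \<open>r\<close> are functions read only below \<open>r\<close>, so
  the dimension is an ordinary term and can be obtained in the middle of a proof.\<close>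

definition ip :: "nat \<Rightarrow> (nat \<Rightarrow> real) \<Rightarrow> (nat \<Rightarrow> real) \<Rightarrow> real" where
  "ip r v w = (\<Sum>i<r. v i * w i)"

lemma ip_commute: "ip r v w = ip r w v"
  by (simp add: ip_def mult.commute)

lemma ip_self_nonneg: "0 \<le> ip r v v"
  by (simp add: ip_def sum_nonneg)

lemma ip_self_eq_0: "ip r v v = 0 \<Longrightarrow> i < r \<Longrightarrow> v i = 0"
  by (simp add: ip_def sum_nonneg_eq_0_iff)

lemma ip_cong_right: "(\<And>i. i < r \<Longrightarrow> w i = w' i) \<Longrightarrow> ip r v w = ip r v w'"
  by (simp add: ip_def)

lemma ip_sum_right: "ip r v (\<lambda>i. \<Sum>k\<in>K. a k * f k i) = (\<Sum>k\<in>K. a k * ip r v (f k))"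
  unfolding ip_def sum_distrib_left by (subst sum.swap) (simp add: mult_ac)

lemma ip_diff_right: "ip r v (\<lambda>i. w i - w' i) = ip r v w - ip r v w'"
  by (simp add: ip_def right_diff_distrib sum_subtractf)

lemma ip_scale_right: "ip r v (\<lambda>i. w i / s) = ip r v w / s"
  by (simp add: ip_def sum_divide_distrib)

lemma ip_Cauchy_Schwarz: "(ip r v w)\<^sup>2 \<le> ip r v v * ip r w w"
  using Cauchy_Schwarz_ineq_sum[of v w "{..<r}"] by (simp add: ip_def power2_eq_square)

text \<open>The regularising term with \<open>\<epsilon>\<close> makes the form definite, so that neither spanning nor general
  position of the vectors \<open>u x\<close> has to be assumed.\<close>

locale weighted_form =
  fixes r :: nat and X :: "'x set" and u :: "'x \<Rightarrow> nat \<Rightarrow> real" and c :: "'x \<Rightarrow> real" and \<epsilon> :: real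
  assumes finite_X: "finite X" and c_nonneg: "x \<in> X \<Longrightarrow> 0 \<le> c x" and eps_pos: "0 < \<epsilon>"
begin

definition form :: "(nat \<Rightarrow> real) \<Rightarrow> (nat \<Rightarrow> real) \<Rightarrow> real" where
  "form v w = \<epsilon> * ip r v w + (\<Sum>x\<in>X. c x * ip r (u x) v * ip r (u x) w)"

lemma form_commute: "form v w = form w v"
  by (simp add: form_def ip_commute[of r v w] mult_ac)

lemma form_cong_right: "(\<And>i. i < r \<Longrightarrow> w i = w' i) \<Longrightarrow> form v w = form v w'"
  unfolding form_def using ip_cong_right[of r w w'] by simp

lemma form_sum_right: "form v (\<lambda>i. \<Sum>k\<in>K. a k * f k i) = (\<Sum>k\<in>K. a k * form v (f k))"
proof -
  have "(\<Sum>x\<in>X. c x * ip r (u x) v * (\<Sum>k\<in>K. a k * ip r (u x) (f k)))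
      = (\<Sum>k\<in>K. a k * (\<Sum>x\<in>X. c x * ip r (u x) v * ip r (u x) (f k)))"
    unfolding sum_distrib_left by (subst sum.swap) (simp add: mult_ac)
  then show ?thesis
    by (simp add: form_def ip_sum_right sum_distrib_left distrib_left sum.distrib mult_ac)
qed

lemma form_diff_right: "form v (\<lambda>i. w i - w' i) = form v w - form v w'"
  by (simp add: form_def ip_diff_right right_diff_distrib sum_subtractf)

lemma form_scale_right: "form v (\<lambda>i. w i / s) = form v w / s"
  by (simp add: form_def ip_scale_right add_divide_distrib sum_divide_distrib)

lemma form_self: "form v v = \<epsilon> * ip r v v + (\<Sum>x\<in>X. c x * (ip r (u x) v)\<^sup>2)"
  by (simp add: form_def power2_eq_square mult.assoc)

lemma form_ge_eps: "\<epsilon> * ip r v v \<le> form v v"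
  unfolding form_self by (simp add: sum_nonneg c_nonneg)

lemma form_ge_weighted: "(\<Sum>x\<in>X. c x * (ip r (u x) v)\<^sup>2) \<le> form v v"
  unfolding form_self using eps_pos ip_self_nonneg[of r v] by simp

lemma form_nonneg: "0 \<le> form v v"
  using form_ge_eps[of v] eps_pos ip_self_nonneg[of r v] by (meson mult_nonneg_nonneg less_imp_le order_trans)

lemma form_eq_0: "form v v = 0 \<Longrightarrow> i < r \<Longrightarrow> v i = 0"
  using form_ge_eps[of v] eps_pos ip_self_nonneg[of r v] ip_self_eq_0[of r v i]
  by (smt (verit) mult_pos_pos)

text \<open>Subtract from \<open>w n\<close> its projection on the vectors found so far. A remainder
  of form 0 vanishes below \<open>r\<close> by definiteness and adds no vector; any other remainder
  is normalised and appended.\<close>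

lemma gram_schmidt:
  fixes n :: nat and w :: "nat \<Rightarrow> nat \<Rightarrow> real"
  shows
  "\<exists>d\<le>n. \<exists>e. (\<forall>k<d. \<forall>l<d. form (e k) (e l) = of_bool (k = l)) \<and>
     (\<forall>i<n. \<exists>a. \<forall>i'<r. w i i' = (\<Sum>k<d. a k * e k i'))"
proof (induction n)
  case 0
  then show ?case by simp
next
  case (Suc n)
  then obtain d e where "d \<le> n" and on: "\<And>k l. k < d \<Longrightarrow> l < d \<Longrightarrow> form (e k) (e l) = of_bool (k = l)"
    and sp: "\<And>i. i < n \<Longrightarrow> \<exists>a. \<forall>i'<r. w i i' = (\<Sum>k<d. a k * e k i')" by blast
  define a where "a k = form (w n) (e k)" for k
  define \<rho> where "\<rho> i = w n i - (\<Sum>k<d. a k * e k i)" for i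
  have orth: "form (e l) \<rho> = 0" if "l < d" for l
  proof -
    have "form (e l) \<rho> = form (e l) (w n) - (\<Sum>k<d. a k * form (e l) (e k))"
      by (simp add: \<rho>_def[abs_def] form_diff_right form_sum_right)
    also have "(\<Sum>k<d. a k * form (e l) (e k)) = (\<Sum>k<d. if k = l then a k else 0)"
      by (intro sum.cong) (use on that in auto)
    finally show ?thesis using that by (simp add: a_def form_commute)
  qed
  show ?case
  proof (cases "form \<rho> \<rho> = 0")
    case True
    then have "\<forall>i'<r. w n i' = (\<Sum>k<d. a k * e k i')"
      using form_eq_0[of \<rho>] by (simp add: \<rho>_def)
    then have "\<forall>i<Suc n. \<exists>a. \<forall>i'<r. w i i' = (\<Sum>k<d. a k * e k i')"
      using sp by (metis less_SucE)
    with \<open>d \<le> n\<close> on show ?thesis by (intro exI[of _ d] conjI exI[of _ e]) auto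
  next
    case False
    define s where "s = sqrt (form \<rho> \<rho>)"
    have s: "s > 0" "s * s = form \<rho> \<rho>"
      using False form_nonneg[of \<rho>] by (auto simp: s_def less_le)
    define e' where "e' = e(d := \<lambda>i. \<rho> i / s)"
    have 1: "form (e' k) (e' l) = of_bool (k = l)" if "k < Suc d" "l < Suc d" for k l
    proof -
      have "form (\<lambda>i. \<rho> i / s) (\<lambda>i. \<rho> i / s) = form \<rho> \<rho> / (s * s)"
        by (simp add: form_scale_right form_commute[of "\<lambda>i. \<rho> i / s"])
      then have A: "form (\<lambda>i. \<rho> i / s) (\<lambda>i. \<rho> i / s) = 1" using s False by simp
      have B: "form (e j) (\<lambda>i. \<rho> i / s) = 0" if "j < d" for j
        using orth[OF that] by (simp add: form_scale_right)
      from that consider "k < d" "l < d" | "k < d" "l = d" | "k = d" "l < d" | "k = d" "l = d"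
        by linarith
      then show ?thesis
        by cases (use A B on form_commute in \<open>auto simp: e'_def\<close>)
    qed
    have lift: "\<exists>a'. \<forall>i'<r. f i' = (\<Sum>k<Suc d. a' k * e' k i')"
      if "\<forall>i'<r. f i' = (\<Sum>k<d. a k * e k i') + t * \<rho> i'" for f a t
      using that s by (intro exI[of _ "a(d := t * s)"]) (simp add: e'_def)
    have 2: "\<exists>a. \<forall>i'<r. w i i' = (\<Sum>k<Suc d. a k * e' k i')" if "i < Suc n" for i
    proof (cases "i < n")
      case True
      from sp[OF True] obtain b where "\<forall>i'<r. w i i' = (\<Sum>k<d. b k * e k i')" by blast
      then show ?thesis by (intro lift[of _ b 0]) simp
    next
      case False
      then have "i = n" using that by simp
      then show ?thesis by (intro lift[of _ a 1]) (simp add: \<rho>_def)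
    qed
    show ?thesis using \<open>d \<le> n\<close> 1 2 by (intro exI[of _ "Suc d"] conjI exI[of _ e']) auto
  qed
qed

text \<open>In a basis orthonormal for \<open>form\<close>, the form becomes the standard inner
  product and each functional \<open>u x\<close> a vector \<open>g x\<close>; this replaces
  inverting the Gram matrix. The trace bound sums \<open>form_ge_weighted\<close> over the at most
  \<open>r\<close> basis vectors.\<close>

lemma orthonormal_coordinates:
  "\<exists>d g. (\<Sum>x\<in>X. c x * ip d (g x) (g x)) \<le> real r \<and>
     (\<forall>v. \<exists>\<alpha>. (\<forall>x. ip r (u x) v = ip d (g x) \<alpha>) \<and> form v v = ip d \<alpha> \<alpha>) \<and>
     (\<forall>\<alpha>. \<exists>v. (\<forall>x. ip r (u x) v = ip d (g x) \<alpha>) \<and> form v v = ip d \<alpha> \<alpha>)"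
proof -
  from gram_schmidt[of r "\<lambda>i i'. of_bool (i = i')"] obtain d e where d: "d \<le> r"
    and on: "\<And>k l. k < d \<Longrightarrow> l < d \<Longrightarrow> form (e k) (e l) = of_bool (k = l)"
    and sp: "\<forall>i<r. \<exists>a. \<forall>i'<r. of_bool (i = i') = (\<Sum>k<d. a k * e k i')" by blast
  from sp obtain a where a: "\<And>i i'. i < r \<Longrightarrow> i' < r \<Longrightarrow> of_bool (i = i') = (\<Sum>k<d. a i k * e k i')"
    by metis
  define g where "g x k = ip r (u x) (e k)" for x k
  define comb where "comb \<alpha> i = (\<Sum>k<d. \<alpha> k * e k i)" for \<alpha> i
  have ip_comb: "ip r (u x) (comb \<alpha>) = ip d (g x) \<alpha>" for x \<alpha>
    unfolding comb_def[abs_def] ip_sum_right by (simp add: g_def ip_def[of d] mult.commute)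
  have form_comb: "form (comb \<alpha>) (comb \<alpha>) = ip d \<alpha> \<alpha>" for \<alpha>
  proof -
    have "form (e k) (comb \<alpha>) = \<alpha> k" if "k < d" for k
    proof -
      have "form (e k) (comb \<alpha>) = (\<Sum>l<d. \<alpha> l * form (e k) (e l))"
        unfolding comb_def[abs_def] form_sum_right ..
      also have "\<dots> = (\<Sum>l<d. if l = k then \<alpha> l else 0)"
        by (intro sum.cong) (use on that in auto)
      finally show ?thesis using that by simp
    qed
    moreover have "form (comb \<alpha>) (comb \<alpha>) = (\<Sum>k<d. \<alpha> k * form (comb \<alpha>) (e k))"
      by (subst (2) comb_def[abs_def]) (rule form_sum_right)
    ultimately show ?thesis by (simp add: ip_def form_commute)
  qed
  have "(\<Sum>x\<in>X. c x * ip d (g x) (g x)) = (\<Sum>k<d. \<Sum>x\<in>X. c x * (ip r (u x) (e k))\<^sup>2)"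
    unfolding ip_def[of d] sum_distrib_left g_def by (subst sum.swap) (simp add: power2_eq_square)
  also have "\<dots> \<le> (\<Sum>k<d. form (e k) (e k))"
    by (intro sum_mono form_ge_weighted)
  also have "\<dots> \<le> real r" using on d by simp
  finally have 1: "(\<Sum>x\<in>X. c x * ip d (g x) (g x)) \<le> real r" .
  have 2: "\<exists>\<alpha>. (\<forall>x. ip r (u x) v = ip d (g x) \<alpha>) \<and> form v v = ip d \<alpha> \<alpha>" for v
  proof -
    define \<alpha> where "\<alpha> k = (\<Sum>i<r. v i * a i k)" for k
    have eq: "v i = comb \<alpha> i" if "i < r" for i
    proof -
      have "comb \<alpha> i = (\<Sum>j<r. v j * (\<Sum>k<d. a j k * e k i))"
        unfolding comb_def \<alpha>_def sum_distrib_left sum_distrib_right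
        by (subst sum.swap) (simp add: mult_ac)
      also have "\<dots> = (\<Sum>j<r. if j = i then v j else 0)"
        by (intro sum.cong) (use a that in \<open>auto simp flip: a\<close>)
      finally show ?thesis using that by simp
    qed
    have "form v v = form (comb \<alpha>) (comb \<alpha>)"
      using form_cong_right[of v "comb \<alpha>"] eq form_commute by metis
    then show ?thesis
      using ip_cong_right[of r v "comb \<alpha>"] eq ip_comb form_comb by (intro exI[of _ \<alpha>]) simp
  qed
  show ?thesis
    using 1 2 ip_comb form_comb by blast
qed

end

section \<open>Maximal admissible weights and Forster's theorem\<close>

text \<open>Here \<open>c x * ip d (g x) (g x)\<close> is the leverage score of \<open>x\<close> for the weights \<open>c\<close>. Raising one weight
  only relaxes the constraint that the other scores are at most \<open>\<kappa>\<close>; so the pointwise supremum of all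
  admissible weights in \<open>[0, 1]\<close> is admissible, and a weight below 1 has score exactly \<open>\<kappa>\<close>.\<close>

lemma lowered_weights:
  fixes u :: "'x \<Rightarrow> nat \<Rightarrow> real"
  assumes fin: "finite X" and eps: "\<epsilon> > 0" and kap: "\<kappa> \<ge> 0"
  obtains c d g where "\<And>x. 0 \<le> c x" "\<And>x. c x \<le> 1"
    "(\<Sum>x\<in>X. c x * ip d (g x) (g x)) \<le> real r"
    "\<And>v. \<exists>\<alpha>. (\<forall>x. ip r (u x) v = ip d (g x) \<alpha>) \<and>
        ip d \<alpha> \<alpha> = \<epsilon> * ip r v v + (\<Sum>x\<in>X. c x * (ip r (u x) v)\<^sup>2)"
    "\<And>x. x \<in> X \<Longrightarrow> c x * ip d (g x) (g x) \<le> \<kappa>"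
    "\<And>x. x \<in> X \<Longrightarrow> c x < 1 \<Longrightarrow> c x * ip d (g x) (g x) \<ge> \<kappa>"
proof -
  define Q where "Q c v = \<epsilon> * ip r v v + (\<Sum>x\<in>X. c x * (ip r (u x) v)\<^sup>2)" for c :: "'x \<Rightarrow> real" and v
  \<comment> \<open>Testing against every \<open>v\<close> expresses a score of at most \<kappa>
    without coordinates. Weights other than \<open>c x\<close> occur only on the right, where
    raising them can only help.\<close>
  define K where "K = {c. (\<forall>x. 0 \<le> c x \<and> c x \<le> 1) \<and> (\<forall>x\<in>X. \<forall>v. c x * (ip r (u x) v)\<^sup>2 \<le> \<kappa> * Q c v)}"
  have Q_nonneg: "0 \<le> Q c v" if "\<And>x. 0 \<le> c x" for c v
    unfolding Q_def using eps that by (intro add_nonneg_nonneg mult_nonneg_nonneg sum_nonneg) (auto simp: ip_self_nonneg)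
  have Q_mono: "Q c v \<le> Q c' v" if "\<And>x. c x \<le> c' x" for c c' v
    unfolding Q_def using that by (intro add_left_mono sum_mono mult_right_mono) auto
  have K0: "(\<lambda>_. 0) \<in> K"
    using kap Q_nonneg[of "\<lambda>_. 0"] by (simp add: K_def)
  define c where "c x = (SUP c'\<in>K. c' x)" for x
  have bdd: "bdd_above ((\<lambda>c'. c' x) ` K)" for x
    by (rule bdd_aboveI[of _ 1]) (auto simp: K_def)
  have upper: "c' x \<le> c x" if "c' \<in> K" for c' x
    unfolding c_def by (rule cSUP_upper[OF that bdd])
  have least: "c x \<le> b" if "\<And>c'. c' \<in> K \<Longrightarrow> c' x \<le> b" for x b
    unfolding c_def using K0 that by (intro cSUP_least) auto
  have c0: "0 \<le> c x" for x using upper[OF K0] by simp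
  have c1: "c x \<le> 1" for x by (rule least) (simp add: K_def)
  have feasible: "c x * (ip r (u x) v)\<^sup>2 \<le> \<kappa> * Q c v" if "x \<in> X" for x v
  proof (cases "ip r (u x) v = 0")
    case True
    then show ?thesis using kap Q_nonneg[OF c0] by simp
  next
    case False
    have "c x \<le> \<kappa> * Q c v / (ip r (u x) v)\<^sup>2"
    proof (rule least)
      fix c' assume c': "c' \<in> K"
      then have "c' x * (ip r (u x) v)\<^sup>2 \<le> \<kappa> * Q c' v" using that by (simp add: K_def)
      also have "\<dots> \<le> \<kappa> * Q c v" using Q_mono upper[OF c'] kap by (intro mult_left_mono) auto
      finally show "c' x \<le> \<kappa> * Q c v / (ip r (u x) v)\<^sup>2" using False by (simp add: pos_le_divide_eq)
    qed
    then show ?thesis using False by (simp add: pos_le_divide_eq)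
  qed
  interpret weighted_form r X u c \<epsilon>
    by unfold_locales (use fin eps c0 in auto)
  have form_Q: "form v v = Q c v" for v by (simp add: form_self Q_def)
  from orthonormal_coordinates obtain d g where trace: "(\<Sum>x\<in>X. c x * ip d (g x) (g x)) \<le> real r"
    and coord: "\<And>v. \<exists>\<alpha>. (\<forall>x. ip r (u x) v = ip d (g x) \<alpha>) \<and> form v v = ip d \<alpha> \<alpha>"
    and coord': "\<And>\<alpha>. \<exists>v. (\<forall>x. ip r (u x) v = ip d (g x) \<alpha>) \<and> form v v = ip d \<alpha> \<alpha>" by blast
  define \<tau> where "\<tau> x = ip d (g x) (g x)" for x
  have \<tau>0: "0 \<le> \<tau> x" for x by (simp add: \<tau>_def ip_self_nonneg)
  have le: "c x * \<tau> x \<le> \<kappa>" if x: "x \<in> X" for x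
  proof (cases "\<tau> x = 0")
    case True
    then show ?thesis using kap by simp
  next
    case False
    \<comment> \<open>At the vector with coordinates \<open>g x\<close> Cauchy-Schwarz is an
      equality, so the constraint turns into the bound on the score.\<close>
    from coord'[of "g x"] obtain v where "ip r (u x) v = \<tau> x" "Q c v = \<tau> x"
      unfolding \<tau>_def form_Q by blast
    with feasible[OF x, of v] have "(c x * \<tau> x) * \<tau> x \<le> \<kappa> * \<tau> x" by (simp add: power2_eq_square)
    then show ?thesis using False \<tau>0[of x] by (simp add: mult_le_cancel_right)
  qed
  have CS: "(ip r (u x) v)\<^sup>2 \<le> \<tau> x * Q c v" for x v
  proof -
    from coord[of v] obtain \<alpha> where "ip r (u x) v = ip d (g x) \<alpha>" "Q c v = ip d \<alpha> \<alpha>"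
      unfolding form_Q by blast
    then show ?thesis using ip_Cauchy_Schwarz[of d "g x" \<alpha>] by (simp add: \<tau>_def)
  qed
  have ge: "c x * \<tau> x \<ge> \<kappa>" if x: "x \<in> X" "c x < 1" for x
  proof (rule ccontr)
    assume "\<not> \<kappa> \<le> c x * \<tau> x"
    then have lt: "c x * \<tau> x < \<kappa>" by simp
    \<comment> \<open>The raise by \<eta> keeps the weight at most 1 and its score, measured in the
      old form, at most \<kappa>; the new form is only larger. Adding 1 to \<open>\<tau> x\<close>
      avoids a division by 0.\<close>
    define \<eta> where "\<eta> = min (1 - c x) ((\<kappa> - c x * \<tau> x) / (\<tau> x + 1))"
    have \<eta>: "0 < \<eta>" using x lt \<tau>0[of x] by (simp add: \<eta>_def)
    have "\<eta> * \<tau> x \<le> \<eta> * (\<tau> x + 1)" using \<eta> by simp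
    also have "\<eta> * (\<tau> x + 1) \<le> ((\<kappa> - c x * \<tau> x) / (\<tau> x + 1)) * (\<tau> x + 1)"
      using \<tau>0[of x] by (intro mult_right_mono) (auto simp: \<eta>_def)
    also have "\<dots> = \<kappa> - c x * \<tau> x" using \<tau>0[of x] by simp
    finally have \<eta>\<tau>: "(c x + \<eta>) * \<tau> x \<le> \<kappa>" by (simp add: algebra_simps)
    define c' where "c' = c(x := c x + \<eta>)"
    have cc': "c y \<le> c' y" for y using \<eta> by (simp add: c'_def)
    have "c' y * (ip r (u y) v)\<^sup>2 \<le> \<kappa> * Q c' v" if y: "y \<in> X" for y v
    proof -
      have "c' y * (ip r (u y) v)\<^sup>2 \<le> \<kappa> * Q c v"
      proof (cases "y = x")
        case True
        have "(c x + \<eta>) * (ip r (u x) v)\<^sup>2 \<le> (c x + \<eta>) * (\<tau> x * Q c v)"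
          using \<eta> c0[of x] by (intro mult_left_mono CS) auto
        also have "\<dots> \<le> \<kappa> * Q c v"
          using mult_right_mono[OF \<eta>\<tau> Q_nonneg[OF c0]] by (simp add: mult.assoc)
        finally show ?thesis using True by (simp add: c'_def)
      next
        case False
        then show ?thesis using feasible[OF y] by (simp add: c'_def)
      qed
      also have "\<dots> \<le> \<kappa> * Q c' v" using kap by (intro mult_left_mono Q_mono cc')
      finally show ?thesis .
    qed
    moreover have "0 \<le> c' y \<and> c' y \<le> 1" for y
      using c0[of y] c1[of y] \<eta> by (auto simp: c'_def \<eta>_def)
    ultimately have "c' \<in> K" by (simp add: K_def)
    from upper[OF this, of x] \<eta> show False by (simp add: c'_def)
  qed
  show ?thesis
    using that[of c d g] c0 c1 trace coord le ge unfolding form_Q \<tau>_def Q_def by metis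
qed

text \<open>Forster's theorem up to a factor 4: the vectors can be normalised so that the \<open>a x\<close> are nearly
  isotropic. The scores sum to at most \<open>r\<close>, so for \<open>\<kappa> = 2 * r / card X\<close> some weight stays 1; this keeps
  the weighted sum of squares above the regularising term.\<close>

lemma forster:
  fixes u :: "'x \<Rightarrow> nat \<Rightarrow> real" and v :: "'y \<Rightarrow> nat \<Rightarrow> real"
  assumes fin: "finite X" "finite Y" and ne: "X \<noteq> {}" "Y \<noteq> {}"
    and nz: "\<And>x y. x \<in> X \<Longrightarrow> y \<in> Y \<Longrightarrow> ip r (u x) (v y) \<noteq> 0"
  obtains d a b where "\<And>x. x \<in> X \<Longrightarrow> ip d (a x) (a x) = 1" "\<And>y. y \<in> Y \<Longrightarrow> ip d (b y) (b y) = 1"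
    "\<And>x y. x \<in> X \<Longrightarrow> y \<in> Y \<Longrightarrow> sgn (ip d (a x) (b y)) = sgn (ip r (u x) (v y))"
    "\<And>y. y \<in> Y \<Longrightarrow> (\<Sum>x\<in>X. (ip d (a x) (b y))\<^sup>2) \<ge> card X / (4 * real r)"
proof -
  have r: "r > 0"
  proof (rule ccontr)
    assume "\<not> r > 0"
    then have "ip r (u x) (v y) = 0" for x y by (simp add: ip_def)
    then show False using ne nz by blast
  qed
  have M: "card X > 0" using fin ne by (simp add: card_gt_0_iff)
  define \<kappa> where "\<kappa> = 2 * real r / card X"
  have \<kappa>: "\<kappa> > 0" using r M by (simp add: \<kappa>_def)
  \<comment> \<open>A minimum of finitely many positive ratios makes the regularising term at most
    any single square \<open>(ip r (u x) (v y))\<^sup>2\<close>.\<close>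
  obtain \<epsilon> where \<epsilon>: "\<epsilon> > 0" and small: "\<And>x y. x \<in> X \<Longrightarrow> y \<in> Y \<Longrightarrow> \<epsilon> * ip r (v y) (v y) \<le> (ip r (u x) (v y))\<^sup>2"
  proof
    let ?S = "(\<lambda>(x, y). (ip r (u x) (v y))\<^sup>2 / (ip r (v y) (v y) + 1)) ` (X \<times> Y)"
    have S: "finite ?S" "?S \<noteq> {}" using fin ne by auto
    have pos: "ip r w w + 1 > 0" for w using ip_self_nonneg[of r w] by simp
    show "Min ?S > 0" using S nz pos by auto
    fix x y assume xy: "x \<in> X" "y \<in> Y"
    have "Min ?S * ip r (v y) (v y) \<le> Min ?S * (ip r (v y) (v y) + 1)"
      using \<open>Min ?S > 0\<close> by (simp add: less_imp_le)
    also have "\<dots> \<le> (ip r (u x) (v y))\<^sup>2 / (ip r (v y) (v y) + 1) * (ip r (v y) (v y) + 1)"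
      using S xy pos[of "v y"] by (intro mult_right_mono Min_le) auto
    also have "\<dots> = (ip r (u x) (v y))\<^sup>2" using pos[of "v y"] by simp
    finally show "Min ?S * ip r (v y) (v y) \<le> (ip r (u x) (v y))\<^sup>2" .
  qed
  from lowered_weights[OF fin(1) \<epsilon> less_imp_le[OF \<kappa>], of r u] obtain c d g where
    c0: "\<And>x. 0 \<le> c x" and c1: "\<And>x. c x \<le> 1"
    and trace: "(\<Sum>x\<in>X. c x * ip d (g x) (g x)) \<le> real r"
    and coord: "\<And>v. \<exists>\<alpha>. (\<forall>x. ip r (u x) v = ip d (g x) \<alpha>) \<and>
        ip d \<alpha> \<alpha> = \<epsilon> * ip r v v + (\<Sum>x\<in>X. c x * (ip r (u x) v)\<^sup>2)"
    and le: "\<And>x. x \<in> X \<Longrightarrow> c x * ip d (g x) (g x) \<le> \<kappa>"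
    and ge: "\<And>x. x \<in> X \<Longrightarrow> c x < 1 \<Longrightarrow> c x * ip d (g x) (g x) \<ge> \<kappa>" by blast
  define \<tau> where "\<tau> x = ip d (g x) (g x)" for x
  have "\<exists>x0\<in>X. c x0 = 1"
  proof (rule ccontr)
    assume "\<not> (\<exists>x0\<in>X. c x0 = 1)"
    then have "c x < 1" if "x \<in> X" for x using c1[of x] that by (metis order_less_le)
    then have "(\<Sum>x\<in>X. \<kappa>) \<le> (\<Sum>x\<in>X. c x * \<tau> x)"
      unfolding \<tau>_def using ge by (intro sum_mono) auto
    also have "\<dots> \<le> r" using trace by (simp add: \<tau>_def)
    finally show False using M r by (simp add: \<kappa>_def)
  qed
  then obtain x0 where x0: "x0 \<in> X" "c x0 = 1" by blast
  from coord have "\<forall>y. \<exists>\<alpha>. (\<forall>x. ip r (u x) (v y) = ip d (g x) \<alpha>) \<and>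
        ip d \<alpha> \<alpha> = \<epsilon> * ip r (v y) (v y) + (\<Sum>x\<in>X. c x * (ip r (u x) (v y))\<^sup>2)" by blast
  then obtain \<alpha> where \<alpha>: "\<And>x y. ip r (u x) (v y) = ip d (g x) (\<alpha> y)"
    and Q: "\<And>y. ip d (\<alpha> y) (\<alpha> y) = \<epsilon> * ip r (v y) (v y) + (\<Sum>x\<in>X. c x * (ip r (u x) (v y))\<^sup>2)"
    by metis
  define q where "q y = ip d (\<alpha> y) (\<alpha> y)" for y
  have \<tau>: "\<tau> x > 0" if "x \<in> X" for x
  proof -
    obtain y where y: "y \<in> Y" using ne by blast
    have "0 < (ip d (g x) (\<alpha> y))\<^sup>2" using nz[OF that y] \<alpha> by simp
    also have "\<dots> \<le> \<tau> x * q y" unfolding \<tau>_def q_def by (rule ip_Cauchy_Schwarz)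
    finally show ?thesis using ip_self_nonneg[of d "g x"] by (auto simp: \<tau>_def zero_less_mult_iff)
  qed
  have q: "q y > 0" if "y \<in> Y" for y
  proof -
    have "0 < (ip d (g x0) (\<alpha> y))\<^sup>2" using nz[OF x0(1) that] \<alpha> by simp
    also have "\<dots> \<le> \<tau> x0 * q y" unfolding \<tau>_def q_def by (rule ip_Cauchy_Schwarz)
    finally show ?thesis using \<tau>[OF x0(1)] by (simp add: zero_less_mult_iff)
  qed
  have half: "q y \<le> 2 * (\<Sum>x\<in>X. c x * (ip r (u x) (v y))\<^sup>2)" if y: "y \<in> Y" for y
  proof -
    have "\<epsilon> * ip r (v y) (v y) \<le> c x0 * (ip r (u x0) (v y))\<^sup>2" using small[OF x0(1) y] x0 by simp
    also have "\<dots> \<le> (\<Sum>x\<in>X. c x * (ip r (u x) (v y))\<^sup>2)"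
      by (rule member_le_sum[OF x0(1)]) (use fin c0 in auto)
    finally show ?thesis by (simp add: q_def Q)
  qed
  define a where "a x k = g x k / sqrt (\<tau> x)" for x k
  define b where "b y k = \<alpha> y k / sqrt (q y)" for y k
  have ab: "ip d (a x) (b y) = ip r (u x) (v y) / (sqrt (\<tau> x) * sqrt (q y))" for x y
    by (simp add: a_def[abs_def] b_def[abs_def] ip_scale_right ip_commute[of d "\<lambda>k. g x k / sqrt (\<tau> x)"]
        ip_commute[of d "\<alpha> y"] \<alpha>)
  show ?thesis
  proof (rule that[of d a b])
    show "ip d (a x) (a x) = 1" if "x \<in> X" for x
      using \<tau>[OF that] by (simp add: a_def[abs_def] ip_scale_right ip_commute[of d "\<lambda>k. g x k / sqrt (\<tau> x)"] flip: \<tau>_def)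
    show "ip d (b y) (b y) = 1" if "y \<in> Y" for y
      using q[OF that] by (simp add: b_def[abs_def] ip_scale_right ip_commute[of d "\<lambda>k. \<alpha> y k / sqrt (q y)"] flip: q_def)
    show "sgn (ip d (a x) (b y)) = sgn (ip r (u x) (v y))" if "x \<in> X" "y \<in> Y" for x y
      using \<tau>[OF that(1)] q[OF that(2)] by (simp add: ab sgn_divide sgn_mult)
    show "card X / (4 * real r) \<le> (\<Sum>x\<in>X. (ip d (a x) (b y))\<^sup>2)" if y: "y \<in> Y" for y
    proof -
      have "card X / (4 * real r) = 1 / (2 * \<kappa>)" using M r by (simp add: \<kappa>_def)
      also have "\<dots> \<le> (\<Sum>x\<in>X. c x * (ip r (u x) (v y))\<^sup>2) / (\<kappa> * q y)"
        using half[OF y] q[OF y] \<kappa> by (simp add: field_simps)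
      also have "\<dots> = (\<Sum>x\<in>X. c x * (ip r (u x) (v y))\<^sup>2 / (\<kappa> * q y))"
        by (rule sum_divide_distrib)
      also have "\<dots> \<le> (\<Sum>x\<in>X. (ip d (a x) (b y))\<^sup>2)"
      proof (rule sum_mono)
        \<comment> \<open>The score bound says that the weight is at most
          \<open>\<kappa> / \<tau> x\<close>, and dividing by \<open>\<tau> x\<close> is what
          normalising the row vector to length 1 does to the square.\<close>
        fix x assume x: "x \<in> X"
        have "c x * (ip r (u x) (v y))\<^sup>2 * \<tau> x \<le> \<kappa> * (ip r (u x) (v y))\<^sup>2"
          using mult_right_mono[OF le[OF x], of "(ip r (u x) (v y))\<^sup>2"] by (simp add: \<tau>_def mult_ac)
        then show "c x * (ip r (u x) (v y))\<^sup>2 / (\<kappa> * q y) \<le> (ip d (a x) (b y))\<^sup>2"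
          using \<tau>[OF x] q[OF y] \<kappa> by (simp add: ab power_divide power_mult_distrib field_simps)
      qed
      finally show ?thesis .
    qed
  qed
qed

text \<open>Estimate the sum \<open>S\<close> of all \<open>p x y * ip d (a x) (b y)\<close> twice.
  The signs agree, \<open>\<bar>p x y\<bar> \<ge> 1\<close>, and the normalised inner products are
  at most 1 in absolute value, so each term is at least the square of its inner product and
  \<open>forster\<close> bounds \<open>S\<close> from below. Cauchy-Schwarz and the orthogonality of
  the rows bound it from above.\<close>

lemma sign_rank_orthogonal_rows:
  fixes p :: "'x \<Rightarrow> 'y \<Rightarrow> real" and u :: "'x \<Rightarrow> nat \<Rightarrow> real" and v :: "'y \<Rightarrow> nat \<Rightarrow> real"
  assumes fin: "finite X" "finite Y" and ne: "X \<noteq> {}" "Y \<noteq> {}"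
    and orth: "\<And>x x'. x \<in> X \<Longrightarrow> x' \<in> X \<Longrightarrow> x \<noteq> x' \<Longrightarrow> (\<Sum>y\<in>Y. p x y * p x' y) = 0"
    and sq: "\<And>x y. x \<in> X \<Longrightarrow> y \<in> Y \<Longrightarrow> (p x y)\<^sup>2 \<le> E"
    and ge1: "\<And>x y. x \<in> X \<Longrightarrow> y \<in> Y \<Longrightarrow> \<bar>p x y\<bar> \<ge> 1"
    and sign: "\<And>x y. x \<in> X \<Longrightarrow> y \<in> Y \<Longrightarrow> 0 < p x y * ip r (u x) (v y)"
  shows "real (card X) \<le> 16 * (real r)\<^sup>2 * E"
proof -
  have nz: "ip r (u x) (v y) \<noteq> 0" if "x \<in> X" "y \<in> Y" for x y
    using sign[OF that] by auto
  from forster[of X Y r u v, OF fin ne nz] obtain d a b where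
    a1: "\<And>x. x \<in> X \<Longrightarrow> ip d (a x) (a x) = 1" and b1: "\<And>y. y \<in> Y \<Longrightarrow> ip d (b y) (b y) = 1"
    and sg: "\<And>x y. x \<in> X \<Longrightarrow> y \<in> Y \<Longrightarrow> sgn (ip d (a x) (b y)) = sgn (ip r (u x) (v y))"
    and mass: "\<And>y. y \<in> Y \<Longrightarrow> (\<Sum>x\<in>X. (ip d (a x) (b y))\<^sup>2) \<ge> card X / (4 * real r)" by blast
  define A where "A y k = (\<Sum>x\<in>X. p x y * a x k)" for y k
  define S where "S = (\<Sum>y\<in>Y. ip d (b y) (A y))"
  have ipA: "ip d w (A y) = (\<Sum>x\<in>X. p x y * ip d w (a x))" for w y
    unfolding A_def[abs_def] by (rule ip_sum_right)
  have entry: "(ip d (a x) (b y))\<^sup>2 \<le> p x y * ip d (b y) (a x)" if xy: "x \<in> X" "y \<in> Y" for x y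
  proof -
    let ?t = "ip d (a x) (b y)"
    have "?t\<^sup>2 \<le> 1" using ip_Cauchy_Schwarz[of d "a x" "b y"] a1 b1 xy by simp
    then have "\<bar>?t\<bar> \<le> 1" by (simp add: abs_square_le_1)
    then have "?t\<^sup>2 \<le> \<bar>?t\<bar>" using mult_left_le_one_le[of "\<bar>?t\<bar>" "\<bar>?t\<bar>"]
      by (simp add: power2_eq_square abs_mult_self_eq)
    also have "\<dots> \<le> \<bar>p x y\<bar> * \<bar>?t\<bar>" using ge1[OF xy] by (simp add: mult_le_cancel_right1)
    also have "\<bar>p x y\<bar> * \<bar>?t\<bar> = p x y * ?t"
      using sign[OF xy] sg[OF xy] by (auto simp: zero_less_mult_iff sgn_if split: if_splits)
    finally show ?thesis by (simp add: ip_commute)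
  qed
  have "real (card Y) * (card X / (4 * real r)) = (\<Sum>y\<in>Y. card X / (4 * real r))" by simp
  also have "\<dots> \<le> (\<Sum>y\<in>Y. \<Sum>x\<in>X. (ip d (a x) (b y))\<^sup>2)" by (intro sum_mono mass)
  also have "\<dots> \<le> S" unfolding S_def ipA by (intro sum_mono entry)
  finally have lower: "real (card Y) * (card X / (4 * real r)) \<le> S" .
  have "S\<^sup>2 \<le> (\<Sum>y\<in>Y. (ip d (b y) (A y))\<^sup>2) * card Y"
    unfolding S_def by (rule sum_squared_le_sum_of_squares)
  also have "\<dots> \<le> (\<Sum>y\<in>Y. ip d (A y) (A y)) * card Y"
    using ip_Cauchy_Schwarz[of d "b y" "A y" for y] b1
    by (intro mult_right_mono sum_mono) (metis mult_1, simp)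
  also have "(\<Sum>y\<in>Y. ip d (A y) (A y)) = (\<Sum>y\<in>Y. \<Sum>x\<in>X. \<Sum>x'\<in>X. p x y * p x' y * ip d (a x) (a x'))"
  proof (intro sum.cong refl)
    fix y
    have "ip d (A y) (A y) = (\<Sum>x\<in>X. p x y * ip d (a x) (A y))"
      unfolding ipA[of "A y"] by (simp add: ip_commute)
    then show "ip d (A y) (A y) = (\<Sum>x\<in>X. \<Sum>x'\<in>X. p x y * p x' y * ip d (a x) (a x'))"
      by (simp add: ipA sum_distrib_left mult.assoc)
  qed
  also have "\<dots> = (\<Sum>x\<in>X. \<Sum>x'\<in>X. (\<Sum>y\<in>Y. p x y * p x' y) * ip d (a x) (a x'))"
    by (subst sum.swap, intro sum.cong refl, subst sum.swap) (simp add: sum_distrib_right)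
  also have "\<dots> = (\<Sum>x\<in>X. \<Sum>x'\<in>X. if x' = x then \<Sum>y\<in>Y. (p x y)\<^sup>2 else 0)"
    by (intro sum.cong refl) (auto simp: orth a1 power2_eq_square)
  also have "\<dots> = (\<Sum>x\<in>X. \<Sum>y\<in>Y. (p x y)\<^sup>2)" using fin by simp
  also have "\<dots> \<le> (\<Sum>x\<in>X. \<Sum>y\<in>Y. E)" by (intro sum_mono sq)
  finally have upper: "S\<^sup>2 \<le> card X * (card Y * E) * card Y" by (simp add: mult_right_mono)
  have r: "r > 0"
  proof (rule ccontr)
    assume "\<not> r > 0"
    then have "ip r (u x) (v y) = 0" for x y by (simp add: ip_def)
    then show False using ne nz by blast
  qed
  have M: "real (card X) > 0" "real (card Y) > 0" using fin ne by (simp_all add: card_gt_0_iff)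
  have "(real (card Y) * (card X / (4 * real r)))\<^sup>2 \<le> S\<^sup>2"
    using lower by (intro power_mono) auto
  also note upper
  finally have "(real (card Y))\<^sup>2 * card X * card X \<le> (real (card Y))\<^sup>2 * card X * (16 * (real r)\<^sup>2 * E)"
    using r by (simp add: field_simps power2_eq_square)
  then show ?thesis using M by (simp add: mult_le_cancel_left)
qed

section \<open>Inner products modulo a prime\<close>

definition dot :: "nat \<Rightarrow> (nat \<Rightarrow> nat) \<Rightarrow> (nat \<Rightarrow> nat) \<Rightarrow> nat" where
  "dot L z w = (\<Sum>i<L. z i * w i)"

lemma periodic_cong:
  fixes p :: "nat \<Rightarrow> 'a"
  assumes per: "\<And>t. p (t + q) = p t" and "[s = t] (mod q)"
  shows "p s = p t"
proof -
  have shift: "p (t + k * q) = p t" for t k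
  proof (induction k)
    case (Suc k)
    have "t + Suc k * q = (t + k * q) + q" by simp
    then show ?case using per[of "t + k * q"] Suc by (simp only:)
  qed simp
  have "p t = p (t mod q)" for t
    using shift[of "t mod q" "t div q"] by simp
  from this[of s] this[of t] assms(2) show ?thesis unfolding cong_def by simp
qed

lemma periodic_sum_shift:
  fixes p :: "nat \<Rightarrow> real"
  assumes per: "\<And>t. p (t + q) = p t"
  shows "(\<Sum>t<q. p (s + t)) = (\<Sum>t<q. p t)"
proof (induction s)
  case (Suc s)
  have "(\<Sum>t<q. p (Suc s + t)) + p s = (\<Sum>t<Suc q. p (s + t))"
    by (subst sum.lessThan_Suc_shift) simp
  also have "\<dots> = (\<Sum>t<q. p (s + t)) + p s" by (simp add: per)
  finally show ?case using Suc by simp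
qed simp

text \<open>Two coordinates suffice: \<open>v i\<close> is \<delta> and \<open>v 0\<close>
  represents \<open>- z i * \<delta>\<close>, where \<delta> inverts \<open>z' i - z i\<close>
  modulo \<open>q\<close>. As both vectors start with 1, the products are 0 and
  \<open>(z' i - z i) * \<delta>\<close>.\<close>

lemma dot_separating_vector:
  assumes q: "prime q" and i: "i < L" "i \<noteq> 0" and z: "z i < q" "z' i < q" "z i \<noteq> z' i"
    and z0: "z 0 = 1" "z' 0 = 1"
  obtains v where "v \<in> {..<L} \<rightarrow>\<^sub>E {..<q}" "[dot L z v = 0] (mod q)" "[dot L z' v = 1] (mod q)"
proof -
  have q0: "q > 0" using q prime_gt_0_nat by blast
  have "\<not> q dvd z' i + (q - z i)"
  proof
    assume "q dvd z' i + (q - z i)"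
    then have "[z' i + (q - z i) = 0] (mod q)" by (simp add: cong_0_iff)
    then have "[z' i + (q - z i) + z i = 0 + z i] (mod q)" using cong_add_rcancel_nat by blast
    then have "[z' i + q = z i] (mod q)" using z by simp
    then show False using z by (simp add: cong_def)
  qed
  then have "coprime (z' i + (q - z i)) q"
    using q prime_imp_coprime coprime_commute by blast
  from cong_solve_coprime_nat[OF this] obtain \<delta> where \<delta>: "[(z' i + (q - z i)) * \<delta> = 1] (mod q)"
    by auto
  define v where "v = (\<lambda>k\<in>{..<L}. if k = i then \<delta> mod q else if k = 0 then (q - z i) * \<delta> mod q else 0)"
  have dot_eq: "dot L w v = w i * (\<delta> mod q) + w 0 * ((q - z i) * \<delta> mod q)" for w
  proof -
    have "dot L w v = (\<Sum>k<L. (if k = i then w i * (\<delta> mod q) else 0) + (if k = 0 then w 0 * ((q - z i) * \<delta> mod q) else 0))"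
      unfolding dot_def using i by (intro sum.cong refl) (auto simp: v_def)
    then show ?thesis using i by (simp add: sum.distrib)
  qed
  then have dot_v: "[dot L w v = (w i + (q - z i)) * \<delta>] (mod q)" if "w 0 = 1" for w
  proof -
    have "[w i * (\<delta> mod q) + w 0 * ((q - z i) * \<delta> mod q) = w i * \<delta> + 1 * ((q - z i) * \<delta>)] (mod q)"
      unfolding that by (intro cong_add cong_scalar_left) (simp_all add: cong_def)
    then show ?thesis by (simp only: dot_eq distrib_right mult_1)
  qed
  show ?thesis
  proof
    show "v \<in> {..<L} \<rightarrow>\<^sub>E {..<q}" using q0 by (auto simp: v_def)
    show "[dot L z v = 0] (mod q)" using dot_v[of z, OF z0(1)] z by (simp add: cong_def)
    show "[dot L z' v = 1] (mod q)" using dot_v[of "z'", OF z0(2)] \<delta> by (rule cong_trans)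
  qed
qed

text \<open>Translating \<open>w\<close> by multiples of a vector that is orthogonal to \<open>z\<close> but not to \<open>z'\<close> averages
  \<open>p (dot L z' w)\<close> to 0 while \<open>p (dot L z w)\<close> stays fixed.\<close>

lemma dot_rows_orthogonal:
  fixes p :: "nat \<Rightarrow> real"
  assumes q: "prime q" and per: "\<And>t. p (t + q) = p t" and bal: "(\<Sum>t<q. p t) = 0"
    and z: "z \<in> {..<L} \<rightarrow>\<^sub>E {..<q}" "z' \<in> {..<L} \<rightarrow>\<^sub>E {..<q}" "z \<noteq> z'" "z 0 = 1" "z' 0 = 1"
  shows "(\<Sum>w\<in>{..<L} \<rightarrow>\<^sub>E {..<q}. p (dot L z w) * p (dot L z' w)) = 0" (is "?G = 0")
proof -
  let ?Y = "{..<L} \<rightarrow>\<^sub>E {..<q}"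
  have q0: "q > 0" using q prime_gt_0_nat by blast
  have finY: "finite ?Y" by (simp add: finite_PiE)
  have "\<exists>i\<in>{..<L}. z i \<noteq> z' i" using PiE_ext[OF z(1,2)] z(3) by blast
  then obtain i where i: "i < L" "z i \<noteq> z' i" by auto
  moreover have "i \<noteq> 0" using i(2) z(4,5) by metis
  moreover have "z i < q" "z' i < q" using i(1) z(1,2) by (auto simp: PiE_iff)
  ultimately obtain v where v: "v \<in> ?Y" "[dot L z v = 0] (mod q)" "[dot L z' v = 1] (mod q)"
    using dot_separating_vector[OF q, of i L z z'] i(2) z(4,5) by blast
  have shift: "?G = (\<Sum>w\<in>?Y. p (dot L z w) * p (dot L z' w + \<tau>))" for \<tau>
  proof -
    \<comment> \<open>Translation by \<open>\<tau> * v\<close> permutes the columns, fixes the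
      product with \<open>z\<close> modulo \<open>q\<close> and adds \<tau> to the product with
      \<open>z'\<close>.\<close>
    define \<phi> where "\<phi> w = (\<lambda>k\<in>{..<L}. (w k + \<tau> * v k) mod q)" for w
    have into: "\<phi> ` ?Y \<subseteq> ?Y"
      using q0 by (intro image_subsetI) (simp add: \<phi>_def PiE_iff)
    have "inj_on \<phi> ?Y"
    proof (rule inj_onI)
      fix w w' assume w: "w \<in> ?Y" "w' \<in> ?Y" and eq: "\<phi> w = \<phi> w'"
      show "w = w'"
      proof (rule PiE_ext[OF w])
        fix k assume k: "k \<in> {..<L}"
        from k have "[w k + \<tau> * v k = w' k + \<tau> * v k] (mod q)"
          using fun_cong[OF eq, of k] by (simp add: \<phi>_def cong_def)
        then have "[w k = w' k] (mod q)" using cong_add_rcancel_nat by blast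
        moreover have "w k < q" "w' k < q" using w k by (auto simp: PiE_iff)
        ultimately show "w k = w' k" by (simp add: cong_def)
      qed
    qed
    then have bij: "bij_betw \<phi> ?Y ?Y"
      using into finY by (simp add: bij_betw_def endo_inj_surj)
    have dot_\<phi>: "[dot L x (\<phi> w) = dot L x w + \<tau> * dot L x v] (mod q)" for x w
    proof -
      have "[dot L x (\<phi> w) = (\<Sum>k<L. x k * (w k + \<tau> * v k))] (mod q)"
        unfolding dot_def by (intro cong_sum cong_scalar_left) (simp add: \<phi>_def cong_def)
      also have "(\<Sum>k<L. x k * (w k + \<tau> * v k)) = dot L x w + \<tau> * dot L x v"
        by (simp add: dot_def algebra_simps sum.distrib sum_distrib_left)
      finally show ?thesis .
    qed
    have "?G = (\<Sum>w\<in>?Y. p (dot L z (\<phi> w)) * p (dot L z' (\<phi> w)))"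
      by (rule sum.reindex_bij_betw[OF bij, symmetric])
    also have "\<dots> = (\<Sum>w\<in>?Y. p (dot L z w) * p (dot L z' w + \<tau>))"
    proof (intro sum.cong refl arg_cong2[of _ _ _ _ "(*)"])
      fix w
      have "[\<tau> * dot L z v = \<tau> * 0] (mod q)"
        by (rule cong_scalar_left) (rule v)
      then have "[dot L z w + \<tau> * dot L z v = dot L z w + \<tau> * 0] (mod q)"
        by (rule cong_add[OF cong_refl])
      from periodic_cong[of p q, OF per cong_trans[OF dot_\<phi> this]]
      show "p (dot L z (\<phi> w)) = p (dot L z w)" by simp
      have "[\<tau> * dot L z' v = \<tau> * 1] (mod q)"
        by (rule cong_scalar_left) (rule v)
      then have "[dot L z' w + \<tau> * dot L z' v = dot L z' w + \<tau> * 1] (mod q)"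
        by (rule cong_add[OF cong_refl])
      from periodic_cong[of p q, OF per cong_trans[OF dot_\<phi> this]]
      show "p (dot L z' (\<phi> w)) = p (dot L z' w + \<tau>)" by simp
    qed
    finally show ?thesis .
  qed
  \<comment> \<open>Summing over all \<tau> turns the second factor into a sum of \<open>p\<close>
    over a full period, which is 0.\<close>
  have "real q * ?G = (\<Sum>\<tau><q. ?G)" by simp
  also have "\<dots> = (\<Sum>\<tau><q. \<Sum>w\<in>?Y. p (dot L z w) * p (dot L z' w + \<tau>))"
    by (intro sum.cong refl shift)
  also have "\<dots> = (\<Sum>w\<in>?Y. p (dot L z w) * (\<Sum>\<tau><q. p (dot L z' w + \<tau>)))"
    by (subst sum.swap) (simp add: sum_distrib_left)
  also have "\<dots> = 0" by (simp add: periodic_sum_shift[of p q, OF per] bal)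
  finally show ?thesis using q0 by simp
qed

lemma sign_rank_dot:
  fixes h :: "nat \<Rightarrow> real" and u v :: "(nat \<Rightarrow> nat) \<Rightarrow> nat \<Rightarrow> real"
  assumes q: "prime q" and per: "\<And>t. h (t + q) = h t" and pm: "\<And>t. h t \<in> {-1, 1}"
    and nonconst: "h s \<noteq> h s'"
    and sign: "\<And>z w. z \<in> {..<Suc N} \<rightarrow>\<^sub>E {..<q} \<Longrightarrow> w \<in> {..<Suc N} \<rightarrow>\<^sub>E {..<q} \<Longrightarrow>
      0 < h (dot (Suc N) z w) * ip r (u z) (v w)"
  shows "real q ^ N \<le> 16 * (real r)\<^sup>2 * (real q)\<^sup>2"
proof -
  let ?Y = "{..<Suc N} \<rightarrow>\<^sub>E {..<q}"
  \<comment> \<open>Distinct rows that start with 1 are not proportional modulo \<open>q\<close>, so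
    they can be separated. Fixing this coordinate is why \<open>Suc N\<close> coordinates yield the
    exponent \<open>N\<close>.\<close>
  define X where "X = (\<Pi>\<^sub>E i\<in>{..<Suc N}. if i = 0 then {1} else {..<q})"
  define \<P> where "\<P> = {t. t < q \<and> h t = 1}"
  define \<M> where "\<M> = {t. t < q \<and> h t = -1}"
  have q1: "q > 1" using q prime_gt_1_nat by blast
  have Xz: "z \<in> ?Y" "z 0 = 1" if "z \<in> X" for z
    using that q1 unfolding X_def PiE_iff by (auto split: if_splits)
  have cardX: "card X = q ^ N"
    unfolding X_def by (subst card_PiE) (simp_all only: prod.lessThan_Suc_shift, simp_all)
  have split: "{..<q} = \<P> \<union> \<M>" "\<P> \<inter> \<M> = {}" "finite \<P>" "finite \<M>"
    using pm by (auto simp: \<P>_def \<M>_def)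
  have hmod: "h t = h (t mod q)" for t by (rule periodic_cong[of h q, OF per]) simp
  have "s mod q \<in> \<P> \<and> s' mod q \<in> \<M> \<or> s mod q \<in> \<M> \<and> s' mod q \<in> \<P>"
    using nonconst hmod[of s] hmod[of s'] pm[of s] pm[of s'] q1 by (auto simp: \<P>_def \<M>_def)
  then have ne: "\<P> \<noteq> {}" "\<M> \<noteq> {}" by blast+
  \<comment> \<open>The opposite class sizes as weights give \<open>h\<close> mean 0 on a period.\<close>
  define p where "p t = h t * (if h t = 1 then card \<M> else card \<P>)" for t
  have p_per: "p (t + q) = p t" for t by (simp add: p_def per)
  have bal: "(\<Sum>t<q. p t) = 0"
  proof -
    have "(\<Sum>t<q. p t) = (\<Sum>t\<in>\<P>. real (card \<M>)) + (\<Sum>t\<in>\<M>. - real (card \<P>))"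
      unfolding split(1) using split(2-4)
      by (subst sum.union_disjoint) (auto simp: p_def \<P>_def \<M>_def intro!: arg_cong2[of _ _ _ _ "(+)"] sum.cong)
    then show ?thesis by simp
  qed
  have "card \<P> \<le> card {..<q}" "card \<M> \<le> card {..<q}"
    by (intro card_mono finite_lessThan; use split(1) in blast)+
  then have cards: "1 \<le> card \<P>" "1 \<le> card \<M>" "card \<P> \<le> q" "card \<M> \<le> q"
    using ne split(3,4) by (simp_all add: Suc_le_eq card_gt_0_iff)
  have habs: "\<bar>h t\<bar> = 1" for t using pm[of t] by auto
  have "real (card X) \<le> 16 * (real r)\<^sup>2 * (real q)\<^sup>2"
  proof (rule sign_rank_orthogonal_rows[where p = "\<lambda>z w. p (dot (Suc N) z w)" and Y = ?Y])
    show "finite X" unfolding X_def by (intro finite_PiE) auto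
    show "finite ?Y" by (intro finite_PiE) auto
    show "X \<noteq> {}" using cardX q1 by auto
    then show "?Y \<noteq> {}" using Xz by auto
    show "(\<Sum>w\<in>?Y. p (dot (Suc N) z w) * p (dot (Suc N) z' w)) = 0" if "z \<in> X" "z' \<in> X" "z \<noteq> z'" for z z'
      by (rule dot_rows_orthogonal[of q p, OF q p_per bal Xz(1)[OF that(1)] Xz(1)[OF that(2)] that(3)
            Xz(2)[OF that(1)] Xz(2)[OF that(2)]])
    fix z w assume zw: "z \<in> X" "w \<in> ?Y"
    have bound: "1 \<le> \<bar>p t\<bar> \<and> \<bar>p t\<bar> \<le> q" for t
      using cards by (auto simp: p_def abs_mult habs)
    then show "1 \<le> \<bar>p (dot (Suc N) z w)\<bar>" by blast
    show "(p (dot (Suc N) z w))\<^sup>2 \<le> (real q)\<^sup>2"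
      using bound by (simp add: abs_le_square_iff[symmetric])
    have "p (dot (Suc N) z w) * ip r (u z) (v w) = (h (dot (Suc N) z w) * ip r (u z) (v w)) *
        (if h (dot (Suc N) z w) = 1 then card \<M> else card \<P>)"
      by (simp add: p_def)
    also have "\<dots> > 0"
      by (rule mult_pos_pos) (use sign[OF Xz(1)[OF zw(1)] zw(2)] cards in auto)
    finally show "0 < p (dot (Suc N) z w) * ip r (u z) (v w)" .
  qed
  then show ?thesis by (simp add: cardX)
qed

section \<open>Sign rank of threshold circuits\<close>

lemma sum_lessThan_add:
  fixes f :: "nat \<Rightarrow> 'a::comm_monoid_add"
  shows "(\<Sum>i<r + s. f i) = (\<Sum>i<r. f i) + (\<Sum>i<s. f (r + i))"
  by (induction s) (simp_all add: add.assoc)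

text \<open>A factorisation through dimension \<open>r\<close> amounts to rank at most
  \<open>r\<close> of the matrix of \<open>f\<close> on the cube. The factors supply the vectors for
  \<open>sign_rank_dot\<close>.\<close>

definition rank_le :: "nat \<Rightarrow> nat \<Rightarrow> two_party \<Rightarrow> bool" where
  "rank_le n r f \<longleftrightarrow> (\<exists>a b. \<forall>x\<in>cube n. \<forall>y\<in>cube n. f x y = ip r (a x) (b y))"

lemma rank_leI: "(\<And>x y. x \<in> cube n \<Longrightarrow> y \<in> cube n \<Longrightarrow> f x y = ip r (a x) (b y)) \<Longrightarrow> rank_le n r f"
  unfolding rank_le_def by blast

lemma rank_le_cong:
  "rank_le n r f \<Longrightarrow> (\<And>x y. x \<in> cube n \<Longrightarrow> y \<in> cube n \<Longrightarrow> f x y = g x y) \<Longrightarrow> rank_le n r g"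
  unfolding rank_le_def by metis

lemma rank_le_zero: "rank_le n r (\<lambda>x y. 0)"
  by (rule rank_leI[where a = "\<lambda>_ _. 0"]) (simp add: ip_def)

lemma rank_le_const: "rank_le n 1 (\<lambda>x y. t)"
  by (rule rank_leI[where a = "\<lambda>_ _. t" and b = "\<lambda>_ _. 1"]) (simp add: ip_def)

lemma rank_le_add:
  assumes "rank_le n r f" "rank_le n s g"
  shows "rank_le n (r + s) (\<lambda>x y. f x y + g x y)"
proof -
  from assms obtain a b a' b' where
    "\<And>x y. x \<in> cube n \<Longrightarrow> y \<in> cube n \<Longrightarrow> f x y = ip r (a x) (b y)"
    "\<And>x y. x \<in> cube n \<Longrightarrow> y \<in> cube n \<Longrightarrow> g x y = ip s (a' x) (b' y)"
    unfolding rank_le_def by blast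
  then show ?thesis
    by (intro rank_leI[where a = "\<lambda>x i. if i < r then a x i else a' x (i - r)"
          and b = "\<lambda>y i. if i < r then b y i else b' y (i - r)"])
      (simp add: ip_def sum_lessThan_add)
qed

lemma rank_le_mono:
  assumes "rank_le n r f" "r \<le> s"
  shows "rank_le n s f"
  using rank_le_add[OF assms(1) rank_le_zero[of n "s - r"]] assms(2) by simp

text \<open>Entrywise multiplication by a matrix of rank at most 1 does not raise the rank. It
  serves to restrict to one answer of a player and to weight a gate.\<close>

lemma rank_le_scale:
  assumes "rank_le n r f"
  shows "rank_le n r (\<lambda>x y. s x * t y * f x y)"
proof -
  from assms obtain a b where "\<And>x y. x \<in> cube n \<Longrightarrow> y \<in> cube n \<Longrightarrow> f x y = ip r (a x) (b y)"
    unfolding rank_le_def by blast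
  then show ?thesis
    by (intro rank_leI[where a = "\<lambda>x i. s x * a x i" and b = "\<lambda>y i. t y * b y i"])
      (simp add: ip_def sum_distrib_left mult_ac)
qed

lemma power_two_add_le: "2 ^ a + 2 ^ b \<le> (2::nat) ^ Suc (max a b)"
proof -
  have "(2::nat) ^ a \<le> 2 ^ max a b" "(2::nat) ^ b \<le> 2 ^ max a b"
    by (intro power_increasing; simp)+
  then have "(2::nat) ^ a + 2 ^ b \<le> 2 ^ max a b + 2 ^ max a b" by (rule add_mono)
  then show ?thesis by (simp only: power_Suc mult_2)
qed

text \<open>A message splits the rows or the columns into two parts, and the rank is at most the sum
  of the ranks on both parts. So each bit at most doubles the bound.\<close>

lemma rank_le_run: "rank_le n (2 ^ cost P) (run P)"
proof (induction P)
  case (Leaf v)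
  then show ?case using rank_le_const[of n v] by (auto elim: rank_le_cong)
next
  case (Alice q P Q)
  have "rank_le n (2 ^ cost P + 2 ^ cost Q)
      (\<lambda>x y. of_bool (q x) * 1 * run P x y + of_bool (\<not> q x) * 1 * run Q x y)"
    by (intro rank_le_add rank_le_scale Alice)
  then have "rank_le n (2 ^ cost P + 2 ^ cost Q) (run (Alice q P Q))"
    by (rule rank_le_cong) simp
  moreover have "2 ^ cost P + 2 ^ cost Q \<le> (2::nat) ^ cost (Alice q P Q)"
    using power_two_add_le[of "cost P" "cost Q"] by simp
  ultimately show ?case by (rule rank_le_mono)
next
  case (Bob q P Q)
  have "rank_le n (2 ^ cost P + 2 ^ cost Q)
      (\<lambda>x y. 1 * of_bool (q y) * run P x y + 1 * of_bool (\<not> q y) * run Q x y)"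
    by (intro rank_le_add rank_le_scale Bob)
  then have "rank_le n (2 ^ cost P + 2 ^ cost Q) (run (Bob q P Q))"
    by (rule rank_le_cong) simp
  moreover have "2 ^ cost P + 2 ^ cost Q \<le> (2::nat) ^ cost (Bob q P Q)"
    using power_two_add_le[of "cost P" "cost Q"] by simp
  ultimately show ?case by (rule rank_le_mono)
qed

lemma rank_le_det_cc:
  assumes "det_cc n f \<le> c"
  shows "rank_le n (2 ^ c) f"
proof -
  obtain P where "protocol_computes n P f" "cost P = det_cc n f" using det_cc_attained by blast
  then have "rank_le n (2 ^ det_cc n f) f"
    using rank_le_run[of n P] by (auto simp: protocol_computes_def elim: rank_le_cong)
  then show ?thesis by (rule rank_le_mono) (simp add: assms power_increasing)
qed

lemma det_cc_0_const:
  assumes "det_cc n f = 0"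
  obtains t where "\<And>x y. x \<in> cube n \<Longrightarrow> y \<in> cube n \<Longrightarrow> f x y = t"
proof -
  obtain P where P: "protocol_computes n P f" "cost P = 0" using det_cc_attained assms by metis
  from P(2) obtain t where "P = Leaf t" by (cases P) auto
  with P(1) have "f x y = t" if "x \<in> cube n" "y \<in> cube n" for x y
    using that unfolding protocol_computes_def by (metis run.simps(1))
  then show ?thesis by (rule that)
qed

lemma rank_le_weighted_sum:
  assumes "\<And>w g. (w, g) \<in> set gs \<Longrightarrow> rank_le n r g"
  shows "rank_le n (length gs * r) (\<lambda>x y. \<Sum>(w, g)\<leftarrow>gs. w * g x y)"
  using assms
proof (induction gs)
  case Nil
  then show ?case using rank_le_zero[of n 0] by simp
next
  case (Cons p gs)
  obtain w g where p: "p = (w, g)" by (cases p)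
  have "rank_le n (r + length gs * r) (\<lambda>x y. w * 1 * g x y + (\<Sum>(w, g)\<leftarrow>gs. w * g x y))"
    using Cons p by (intro rank_le_add rank_le_scale) auto
  then show ?case by (simp add: p)
qed

section \<open>Threshold circuits as strict sign representations\<close>

lemma finite_cube: "finite (cube n)"
  using finite_lists_length_eq[of "UNIV :: bool set" n] by (simp add: cube_def)

text \<open>Each gate contributes rank at most \<open>2 ^ c\<close>, and the bias one more. The bias
  is raised by \<eta> because a sum equal to 0 evaluates to 1, whereas the representation has to be
  strict.\<close>

lemma circuit_sign_representation:
  assumes comp: "circuit_computes n T F" and cc: "\<And>g. g \<in> circuit_gates T \<Longrightarrow> det_cc n g \<le> c"
  obtains u v where "\<And>x y. x \<in> cube n \<Longrightarrow> y \<in> cube n \<Longrightarrow>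
    0 < F x y * ip (circuit_size T * 2 ^ c + 1) (u x) (v y)"
proof -
  obtain b gs where T: "T = THR b gs" by (cases T)
  define S where "S x y = b + (\<Sum>(w, g)\<leftarrow>gs. w * g x y)" for x y
  \<comment> \<open>The inserted -1 makes this set of negative numbers nonempty; \<eta> is half the
    distance from its maximum to 0.\<close>
  define Z where "Z = insert (-1) {t \<in> (\<lambda>(x, y). S x y) ` (cube n \<times> cube n). t < 0}"
  have Z: "finite Z" "Z \<noteq> {}" by (simp_all add: Z_def finite_cube)
  define \<eta> where "\<eta> = - Max Z / 2"
  have \<eta>: "\<eta> > 0" using Z by (auto simp: \<eta>_def Z_def)
  have neg: "S x y + \<eta> < 0" if "x \<in> cube n" "y \<in> cube n" "S x y < 0" for x y
  proof -
    have "S x y \<in> Z" using that by (force simp: Z_def)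
    then have "S x y \<le> Max Z" using Z by simp
    then show ?thesis using \<eta> by (simp add: \<eta>_def)
  qed
  have "rank_le n (length gs * 2 ^ c + 1) (\<lambda>x y. (\<Sum>(w, g)\<leftarrow>gs. w * g x y) + (b + \<eta>))"
    using cc by (intro rank_le_add rank_le_weighted_sum rank_le_const rank_le_det_cc) (force simp: T)
  then obtain u v where uv: "\<And>x y. x \<in> cube n \<Longrightarrow> y \<in> cube n \<Longrightarrow>
      (\<Sum>(w, g)\<leftarrow>gs. w * g x y) + (b + \<eta>) = ip (length gs * 2 ^ c + 1) (u x) (v y)"
    unfolding rank_le_def by blast
  show ?thesis
  proof (rule that[of u v])
    fix x y assume xy: "x \<in> cube n" "y \<in> cube n"
    have F: "F x y = (if S x y \<ge> 0 then 1 else -1)"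
      using comp xy by (simp add: circuit_computes_def T S_def)
    have "ip (circuit_size T * 2 ^ c + 1) (u x) (v y) = S x y + \<eta>"
      using uv[OF xy] by (simp add: T S_def)
    then show "0 < F x y * ip (circuit_size T * 2 ^ c + 1) (u x) (v y)"
      unfolding F using neg[OF xy] \<eta> by auto
  qed
qed

text \<open>Otherwise there is no gate, or a single gate of complexity 0, and the circuit is
  constant. The bound absorbs the additive 1 of the rank and settles the range of small
  exponents.\<close>

lemma circuit_size_ge_2:
  assumes comp: "circuit_computes n T F" and cc: "\<And>g. g \<in> circuit_gates T \<Longrightarrow> det_cc n g \<le> c"
    and nonconst: "\<nexists>t. \<forall>x\<in>cube n. \<forall>y\<in>cube n. F x y = t"
  shows "2 \<le> circuit_size T * 2 ^ c"
proof (rule ccontr)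
  assume small: "\<not> 2 \<le> circuit_size T * 2 ^ c"
  obtain b gs where T: "T = THR b gs" by (cases T)
  define o' where "o' = replicate n False"
  have o': "o' \<in> cube n" by (simp add: o'_def cube_def)
  have gates: "g x y = g o' o'" if "(w, g) \<in> set gs" "x \<in> cube n" "y \<in> cube n" for w g x y
  proof -
    have "g \<in> circuit_gates T" using that by (force simp: T)
    have "circuit_size T \<noteq> 0" using that by (auto simp: T)
    then have "(2::nat) ^ c \<le> circuit_size T * 2 ^ c" by simp
    also have "\<dots> < 2 ^ 1" using small by simp
    finally have "(2::nat) ^ c < 2 ^ 1" .
    then have "c = 0" using power_less_imp_less_exp[of "2::nat" c 1] by simp
    then have "det_cc n g = 0" using cc[OF \<open>g \<in> circuit_gates T\<close>] by simp
    from det_cc_0_const[OF this] show ?thesis using that o' by metis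
  qed
  have "F x y = circuit_eval T o' o'" if xy: "x \<in> cube n" "y \<in> cube n" for x y
  proof -
    have "map (\<lambda>(w, g). w * g x y) gs = map (\<lambda>(w, g). w * g o' o') gs"
      using gates[OF _ xy] by (intro map_cong) auto
    then have "circuit_eval T x y = circuit_eval T o' o'" by (simp only: T circuit_eval.simps)
    then show ?thesis using comp xy by (simp add: circuit_computes_def)
  qed
  with nonconst show False by blast
qed

section \<open>Periodic functions of the Hamming weight\<close>

text \<open>The value of \<open>mod_fn\<close> at Hamming weight \<open>t\<close>, extended to all
  natural numbers so that periodicity holds without a range restriction.\<close>

definition residue_fn :: "nat \<Rightarrow> nat set \<Rightarrow> nat \<Rightarrow> real" where
  "residue_fn m A t = (if \<exists>a\<in>A. [t = a] (mod m) then -1 else 1)"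

lemma mod_fn_eq: "mod_fn m A x = residue_fn m A (bit_sum x)"
  by (simp add: mod_fn_def residue_fn_def)

lemma residue_fn_pm: "residue_fn m A t \<in> {-1, 1}"
  by (simp add: residue_fn_def)

lemma residue_fn_periodic: "residue_fn m A (t + m) = residue_fn m A t"
  by (simp add: residue_fn_def cong_def)

lemma simple_if_period_2:
  assumes per: "\<And>t. residue_fn m A (t + 2) = residue_fn m A t"
  shows "simple n m A"
proof -
  let ?f = "residue_fn m A"
  have f: "?f t = (if even t then ?f 0 else ?f 1)" for t
    using periodic_cong[of ?f 2 t "t mod 2", OF per] by (cases "even t") (simp_all add: cong_def even_iff_mod_2_eq_zero odd_iff_mod_2_eq_one)
  consider "?f 1 = ?f 0" | "?f 0 = 1" "?f 1 = -1" | "?f 0 = -1" "?f 1 = 1"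
    using residue_fn_pm[of m A 0] residue_fn_pm[of m A 1] by fastforce
  then show ?thesis
  proof cases
    case 1
    have "mod_fn m A x = ?f 0" for x
      using f[of "bit_sum x"] 1 by (cases "even (bit_sum x)") (simp_all add: mod_fn_eq)
    then show ?thesis unfolding simple_def by blast
  next
    case 2
    then have "mod_fn m A x = parity x" for x
      using f[of "bit_sum x"] by (simp add: mod_fn_eq parity_def)
    then show ?thesis unfolding simple_def by blast
  next
    case 3
    then have "mod_fn m A x = - parity x" for x
      using f[of "bit_sum x"] by (simp add: mod_fn_eq parity_def)
    then show ?thesis unfolding simple_def by blast
  qed
qed

text \<open>With \<open>P\<close> the least period, \<open>q = 2\<close> and \<open>D = P / 4\<close> work if \<open>4 dvd P\<close>; otherwise \<open>P \<ge> 3\<close> has an odd prime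
  factor \<open>q\<close>, and \<open>D = P / q\<close> works.\<close>

lemma prime_progression:
  fixes f :: "nat \<Rightarrow> real"
  assumes m: "m > 0" "\<And>t. f (t + m) = f t" and no2: "\<not> (\<forall>t. f (t + 2) = f t)"
  obtains q D e s where "prime q" "q = 2 \<or> (odd q \<and> q dvd m)" "D > 0" "D * q \<le> m" "e < m"
    "\<And>t. f (t + 2 * D * q) = f t" "f (e + 2 * D * s) \<noteq> f e"
proof -
  define P where "P = (LEAST P. P > 0 \<and> (\<forall>t. f (t + P) = f t))"
  have P: "P > 0" "\<And>t. f (t + P) = f t"
    using LeastI[of "\<lambda>P. P > 0 \<and> (\<forall>t. f (t + P) = f t)" m] m unfolding P_def by blast+
  have P_least: "P \<le> d" if "d > 0" "\<And>t. f (t + d) = f t" for d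
    unfolding P_def by (rule Least_le) (use that in blast)
  have P_mod: "f s = f t" if "[s = t] (mod P)" for s t
    using periodic_cong[of f P, OF P(2) that] .
  have "P dvd m"
  proof (rule ccontr)
    assume "\<not> P dvd m"
    then have "m mod P > 0" by (simp add: dvd_eq_mod_eq_0)
    moreover have "f (t + m mod P) = f t" for t
    proof -
      have "f (t + m mod P) = f (t + m)" by (rule P_mod) (simp add: cong_def mod_simps)
      then show ?thesis using m by simp
    qed
    ultimately have "P \<le> m mod P" by (rule P_least)
    then show False using mod_less_divisor[OF P(1), of m] by linarith
  qed
  then have "P \<le> m" using m by (simp add: dvd_imp_le)
  have not_period: "\<exists>e<P. f (e + d) \<noteq> f e" if d: "0 < d" "d < P" for d
  proof -
    have "\<not> (\<forall>t. f (t + d) = f t)" using P_least[of d] d by (meson leD)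
    then obtain t where t: "f (t + d) \<noteq> f t" by blast
    have "f (t mod P + d) = f (t + d)" "f (t mod P) = f t"
      by (rule P_mod, simp add: cong_def mod_simps)+
    with t show ?thesis using P(1) by (intro exI[of _ "t mod P"]) simp
  qed
  have "P \<noteq> 1"
  proof
    assume "P = 1"
    then have "f s = f t" for s t using P_mod[of s t] by simp
    with no2 show False by blast
  qed
  moreover have "P \<noteq> 2" using no2 P(2) by blast
  ultimately have P3: "P \<ge> 3" using P(1) by linarith
  show ?thesis
  proof (cases "4 dvd P")
    case True
    then obtain D where D: "P = 4 * D" by blast
    with P(1) have "D > 0" by simp
    \<comment> \<open>Half the least period is not a period, so somewhere one step of
      \<open>2 * D\<close> changes the value, while two steps never do.\<close>
    with not_period[of "2 * D"] D obtain e where e: "e < P" "f (e + 2 * D * 1) \<noteq> f e" by auto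
    show ?thesis
    proof (rule that[of 2 D e 1])
      show "f (t + 2 * D * 2) = f t" for t using P(2)[of t] by (simp add: D mult.commute)
    qed (use e D \<open>D > 0\<close> \<open>P \<le> m\<close> in auto)
  next
    case False
    have "\<exists>q. prime q \<and> odd q \<and> q dvd P"
    proof (cases "odd P")
      case True
      with prime_factor_nat[OF \<open>P \<noteq> 1\<close>] show ?thesis using dvd_trans by blast
    next
      case even: False
      then obtain P' where P': "P = 2 * P'" by blast
      with False have "odd P'" by (auto elim!: evenE)
      moreover have "P' \<noteq> 1" using P' P3 by auto
      ultimately show ?thesis using prime_factor_nat[of P'] dvd_trans dvd_mult unfolding P' by blast
    qed
    then obtain q where q: "prime q" "odd q" "q dvd P" by blast
    then obtain D where D: "P = q * D" by blast
    have "D > 0" using D P(1) by (cases D) auto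
    moreover have "1 < q" using q(1) by (rule prime_gt_1_nat)
    ultimately have "D < P" unfolding D by simp
    with not_period[of D] \<open>D > 0\<close> obtain e where e: "e < P" "f (e + D) \<noteq> f e" by blast
    \<comment> \<open>The step \<open>2 * D\<close> is even because the XOR gadget has even weights.
      As \<open>q\<close> is odd, \<open>q' + 1\<close> such steps add up to \<open>D + P\<close>,
      which acts as a shift by \<open>D\<close>.\<close>
    obtain q' where q': "q = 2 * q' + 1" using q(2) by (elim oddE)
    show ?thesis
    proof (rule that[of q D e "q' + 1"])
      have "t + 2 * D * q = (t + P) + P" for t
        by (simp add: D mult.assoc mult.commute[of D])
      then show "f (t + 2 * D * q) = f t" for t
        using P(2)[of t] P(2)[of "t + P"] by metis
      have "e + 2 * D * (q' + 1) = (e + D) + P" by (simp add: D q' algebra_simps)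
      then show "f (e + 2 * D * (q' + 1)) \<noteq> f e" using P(2)[of "e + D"] e(2) by metis
      show "q = 2 \<or> odd q \<and> q dvd m" using q \<open>P dvd m\<close> by (metis dvd_trans)
      show "D * q \<le> m" using \<open>P \<le> m\<close> by (simp add: D mult.commute)
    qed (use q e \<open>D > 0\<close> \<open>P \<le> m\<close> in auto)
  qed
qed

section \<open>Inner products realised as Hamming weights of an XOR\<close>

lemma bit_sum_append: "bit_sum (x @ y) = bit_sum x + bit_sum y"
proof -
  have "bit_sum (x @ y) = (\<Sum>i<length x. of_bool ((x @ y) ! i)) + (\<Sum>i<length y. of_bool ((x @ y) ! (length x + i)))"
    by (simp add: bit_sum_def sum_lessThan_add)
  also have "\<dots> = bit_sum x + bit_sum y"
    by (simp add: bit_sum_def nth_append)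
  finally show ?thesis .
qed

lemma bit_sum_Nil: "bit_sum [] = 0"
  by (simp add: bit_sum_def)

lemma bit_sum_Cons: "bit_sum (b # x) = of_bool b + bit_sum x"
  using bit_sum_append[of "[b]" x] by (simp add: bit_sum_def)

lemma bit_sum_replicate: "bit_sum (replicate l b) = l * of_bool b"
  by (simp add: bit_sum_def)

lemma map2_append:
  "length x = length y \<Longrightarrow> map2 f (x @ x') (y @ y') = map2 f x y @ map2 f x' y'"
  by simp

text \<open>The blocks \<open>(a, a, 0)\<close> and \<open>(b, 0, b)\<close> have an XOR of weight \<open>2 * of_bool (a \<or> b)\<close>.\<close>

definition row_bits :: "('i \<Rightarrow> bool) \<Rightarrow> 'i list \<Rightarrow> bool list" where
  "row_bits a es = concat (map (\<lambda>i. [a i, a i, False]) es)"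

definition col_bits :: "('i \<Rightarrow> bool) \<Rightarrow> 'i list \<Rightarrow> bool list" where
  "col_bits b es = concat (map (\<lambda>i. [b i, False, b i]) es)"

lemma length_row_bits: "length (row_bits a es) = 3 * length es"
  by (induction es) (simp_all add: row_bits_def)

lemma length_col_bits: "length (col_bits b es) = 3 * length es"
  by (induction es) (simp_all add: col_bits_def)

lemma bit_sum_xor_gadget:
  "bit_sum (map2 (\<noteq>) (row_bits a es) (col_bits b es)) = (\<Sum>i\<leftarrow>es. 2 * of_bool (a i \<or> b i))"
proof (induction es)
  case Nil
  then show ?case by (simp add: row_bits_def bit_sum_Nil)
next
  case (Cons i es)
  then show ?case by (simp add: row_bits_def col_bits_def bit_sum_Cons)
qed

lemma sum_of_bool_less: "z \<le> l \<Longrightarrow> (\<Sum>a<l. of_bool (a < z)) = (z::nat)"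
proof -
  assume "z \<le> l"
  then have "{..<l} \<inter> {a. a < z} = {..<z}" by auto
  then show ?thesis by (simp add: sum_of_bool_eq Collect_conj_eq[symmetric])
qed

text \<open>In unary, \<open>z i * w i\<close> counts the pairs \<open>(a, b)\<close> with
  \<open>a < z i\<close> and \<open>b < w i\<close>. Every triple \<open>(i, a, b)\<close> gets
  \<open>D\<close> copies of the gadget, and a leading block of \<open>e\<close> differing bits
  gives the offset. The additive form of the equation avoids truncated subtraction.\<close>

lemma xor_embedding_of_dot:
  assumes len: "e + 3 * (L * (q - 1)\<^sup>2 * D) \<le> n"
  obtains X Y where "\<And>z. X z \<in> cube n" "\<And>w. Y w \<in> cube n"
    "\<And>z w. z \<in> {..<L} \<rightarrow>\<^sub>E {..<q} \<Longrightarrow> w \<in> {..<L} \<rightarrow>\<^sub>E {..<q} \<Longrightarrow>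
       bit_sum (map2 (\<noteq>) (X z) (Y w)) + 2 * D * dot L z w = e + 2 * D * (L * (q - 1)\<^sup>2)"
proof -
  define I where "I = {..<L} \<times> {..<q - 1} \<times> {..<q - 1} \<times> {..<D}"
  have "finite I" by (simp add: I_def)
  then obtain es where es: "set es = I" "distinct es" using finite_distinct_list by blast
  have card_I: "card I = L * (q - 1)\<^sup>2 * D" by (simp add: I_def power2_eq_square)
  then have len_es: "length es = L * (q - 1)\<^sup>2 * D" using es distinct_card by metis
  \<comment> \<open>The gadget computes a disjunction, hence the negations: a counted pair is a
    gadget of weight 0, so the inner product is subtracted from the maximal weight.\<close>
  define A where "A z = (\<lambda>(i, a, b :: nat, d :: nat). \<not> a < z i)" for z :: "nat \<Rightarrow> nat"
  define B where "B w = (\<lambda>(i, a :: nat, b, d :: nat). \<not> b < w i)" for w :: "nat \<Rightarrow> nat"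
  define rest where "rest = n - (e + 3 * length es)"
  define X where "X z = replicate e True @ row_bits (A z) es @ replicate rest False" for z
  define Y where "Y w = replicate e False @ col_bits (B w) es @ replicate rest False" for w
  have "e + 3 * length es \<le> n" using len len_es by simp
  then have cubes: "X z \<in> cube n" "Y w \<in> cube n" for z w
    by (simp_all add: X_def Y_def cube_def rest_def length_row_bits length_col_bits)
  have main: "bit_sum (map2 (\<noteq>) (X z) (Y w)) + 2 * D * dot L z w = e + 2 * D * (L * (q - 1)\<^sup>2)"
    if z: "z \<in> {..<L} \<rightarrow>\<^sub>E {..<q}" and w: "w \<in> {..<L} \<rightarrow>\<^sub>E {..<q}" for z w
  proof -
    have le: "z i \<le> q - 1" "w i \<le> q - 1" if "i < L" for i
      using PiE_mem[OF z, of i] PiE_mem[OF w, of i] that by auto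
    have and_count: "(\<Sum>t\<in>I. of_bool (\<not> (A z t \<or> B w t))) = D * dot L z w"
    proof -
      have "(\<Sum>t\<in>I. of_bool (\<not> (A z t \<or> B w t)) :: nat)
          = (\<Sum>i<L. \<Sum>a<q - 1. \<Sum>b<q - 1. \<Sum>d<D. of_bool (a < z i) * of_bool (b < w i))"
        unfolding I_def sum.cartesian_product by (intro sum.cong) (auto simp: A_def B_def)
      also have "\<dots> = (\<Sum>i<L. D * ((\<Sum>a<q - 1. of_bool (a < z i)) * (\<Sum>b<q - 1. of_bool (b < w i))))"
        unfolding sum_product by (simp only: sum_distrib_left sum_constant card_lessThan of_nat_id)
      also have "\<dots> = (\<Sum>i<L. D * (z i * w i))"
        using le by (intro sum.cong refl) (simp only: sum_of_bool_less lessThan_iff)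
      finally show ?thesis by (simp add: dot_def sum_distrib_left)
    qed
    have "map2 (\<noteq>) (X z) (Y w) = map2 (\<noteq>) (replicate e True) (replicate e False) @
        map2 (\<noteq>) (row_bits (A z) es) (col_bits (B w) es) @ map2 (\<noteq>) (replicate rest False) (replicate rest False)"
      unfolding X_def Y_def by (simp only: map2_append length_replicate length_row_bits length_col_bits)
    moreover have "bit_sum (map2 (\<noteq>) (replicate e True) (replicate e False)) = e"
      "bit_sum (map2 (\<noteq>) (replicate rest False) (replicate rest False)) = 0"
      by (simp_all add: zip_replicate map_replicate bit_sum_replicate)
    ultimately have "bit_sum (map2 (\<noteq>) (X z) (Y w)) = e + (\<Sum>t\<leftarrow>es. 2 * of_bool (A z t \<or> B w t))"
      by (simp only: bit_sum_append bit_sum_xor_gadget add_0_right)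
    also have "(\<Sum>t\<leftarrow>es. 2 * of_bool (A z t \<or> B w t)) = (\<Sum>t\<in>I. 2 * of_bool (A z t \<or> B w t))"
      using sum_list_distinct_conv_sum_set[OF es(2)] unfolding es(1) .
    finally have "bit_sum (map2 (\<noteq>) (X z) (Y w)) + 2 * D * dot L z w
        = e + ((\<Sum>t\<in>I. 2 * of_bool (A z t \<or> B w t)) + 2 * (\<Sum>t\<in>I. of_bool (\<not> (A z t \<or> B w t))))"
      by (simp only: and_count mult.assoc add.assoc)
    also have "(\<Sum>t\<in>I. 2 * of_bool (A z t \<or> B w t)) + 2 * (\<Sum>t\<in>I. of_bool (\<not> (A z t \<or> B w t)))
        = (\<Sum>t\<in>I. (2::nat))"
      unfolding sum_distrib_left sum.distrib[symmetric] by (intro sum.cong) auto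
    finally show ?thesis by (simp add: card_I)
  qed
  show ?thesis by (rule that[OF cubes main])
qed

lemma map2_neq_replicate_False: "map2 (\<noteq>) x (replicate (length x) False) = x"
  by (induction x) simp_all

text \<open>Restricting the sign representation of the circuit to the encoded inputs gives one for
  \<open>h (dot (Suc N) z w)\<close>. The offset takes less than \<open>m\<close> bits and each
  coordinate \<open>3 * (q - 1)\<^sup>2 * D \<le> 3 * m * q\<close> bits.\<close>

lemma circuit_size_sign_rank_bound:
  assumes m: "m > 0" and "\<not> simple n m A"
    and comp: "circuit_computes n T (compose_xor (mod_fn m A))"
    and cc: "\<And>g. g \<in> circuit_gates T \<Longrightarrow> det_cc n g \<le> c"
  obtains q where "prime q" "q = 2 \<or> (odd q \<and> q dvd m)"
    "\<And>N. m + 3 * Suc N * m * q \<le> n \<Longrightarrow>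
      real q ^ N \<le> 16 * (real (circuit_size T * 2 ^ c + 1))\<^sup>2 * (real q)\<^sup>2"
proof -
  let ?f = "residue_fn m A" and ?r = "circuit_size T * 2 ^ c + 1"
  have "\<not> (\<forall>t. ?f (t + 2) = ?f t)" using simple_if_period_2 assms(2) by blast
  from prime_progression[of m ?f, OF m residue_fn_periodic this] obtain q D e s where
    q: "prime q" "q = 2 \<or> (odd q \<and> q dvd m)" and D: "D > 0" "D * q \<le> m" and e: "e < m"
    and per: "\<And>t. ?f (t + 2 * D * q) = ?f t" and nonconst: "?f (e + 2 * D * s) \<noteq> ?f e" by blast
  from circuit_sign_representation[OF comp cc] obtain u v where
    uv: "\<And>x y. x \<in> cube n \<Longrightarrow> y \<in> cube n \<Longrightarrow> 0 < compose_xor (mod_fn m A) x y * ip ?r (u x) (v y)"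
    by blast
  have "real q ^ N \<le> 16 * (real ?r)\<^sup>2 * (real q)\<^sup>2" if N: "m + 3 * Suc N * m * q \<le> n" for N
  proof -
    have "(q - 1)\<^sup>2 * D \<le> q * q * D"
      unfolding power2_eq_square by (intro mult_le_mono) auto
    also have "\<dots> \<le> m * q" using mult_right_mono[OF D(2), of q] by (simp add: mult_ac)
    finally have "Suc N * ((q - 1)\<^sup>2 * D) \<le> Suc N * (m * q)" by (rule mult_left_mono) simp
    then have "e + 3 * (Suc N * (q - 1)\<^sup>2 * D) \<le> n"
      using N e by (simp only: mult.assoc)
    from xor_embedding_of_dot[OF this] obtain X Y where
      XY: "\<And>z. X z \<in> cube n" "\<And>w. Y w \<in> cube n"
      and emb: "\<And>z w. z \<in> {..<Suc N} \<rightarrow>\<^sub>E {..<q} \<Longrightarrow> w \<in> {..<Suc N} \<rightarrow>\<^sub>E {..<q} \<Longrightarrow>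
        bit_sum (map2 (\<noteq>) (X z) (Y w)) + 2 * D * dot (Suc N) z w = e + 2 * D * (Suc N * (q - 1)\<^sup>2)"
      by blast
    define K where "K = Suc N * (q - 1)\<^sup>2"
    obtain p where p: "q = p + 2" using prime_ge_2_nat[OF q(1)] by (metis add.commute le_Suc_ex)
    \<comment> \<open>The weight is \<open>e + 2 * D * (K - dot (Suc N) z w)\<close>. Modulo
      \<open>q\<close> the factor \<open>q - 1\<close> is -1, and it keeps the argument a natural
      number.\<close>
    define h where "h t = ?f (e + 2 * D * (K + (q - 1) * t))" for t
    have f_cong: "?f a = ?f b" if "[a = b] (mod (2 * D * q))" for a b
      by (rule periodic_cong[of ?f, OF per that])
    have f_shift: "?f (a + 2 * D * q * t) = ?f a" for a t
      by (rule f_cong) (simp add: cong_def)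
    show ?thesis
    proof (rule sign_rank_dot[of q h, OF q(1)])
      show "h (t + q) = h t" for t
      proof -
        have "e + 2 * D * (K + (q - 1) * (t + q)) = e + 2 * D * (K + (q - 1) * t) + 2 * D * q * (q - 1)"
          by (simp add: p algebra_simps)
        then show ?thesis unfolding h_def by (simp only: f_shift)
      qed
      show "h t \<in> {-1, 1}" for t unfolding h_def by (rule residue_fn_pm)
      \<comment> \<open>Modulo \<open>q\<close>, sending \<open>t\<close> to \<open>K - t\<close> is
        its own inverse, so \<open>h\<close> takes every value along the progression, in particular
        two different ones.\<close>
      have h_onto: "h (K + (q - 1) * t) = ?f (e + 2 * D * t)" for t
      proof -
        have "e + 2 * D * (K + (q - 1) * (K + (q - 1) * t)) = e + 2 * D * t + 2 * D * q * (K + p * t)"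
          by (simp add: p algebra_simps)
        then show ?thesis unfolding h_def by (simp only: f_shift)
      qed
      show "h (K + (q - 1) * s) \<noteq> h (K + (q - 1) * 0)"
        unfolding h_onto using nonconst by simp
      fix z w assume zw: "z \<in> {..<Suc N} \<rightarrow>\<^sub>E {..<q}" "w \<in> {..<Suc N} \<rightarrow>\<^sub>E {..<q}"
      let ?b = "bit_sum (map2 (\<noteq>) (X z) (Y w))" and ?t = "dot (Suc N) z w"
      have "2 * D * q * ?t = 2 * D * ?t + 2 * D * ((q - 1) * ?t)"
        by (simp add: p algebra_simps)
      then have "?b + 2 * D * q * ?t = e + 2 * D * (K + (q - 1) * ?t)"
        using emb[OF zw] by (simp add: K_def distrib_left)
      then have "h ?t = ?f (?b + 2 * D * q * ?t)" unfolding h_def by (rule arg_cong[OF sym])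
      then have "h ?t = ?f ?b" by (simp only: f_shift)
      then show "0 < h ?t * ip ?r ((u \<circ> X) z) ((v \<circ> Y) w)"
        using uv[OF XY, of z w] by (simp add: compose_xor_def mod_fn_eq)
    qed
  qed
  with q show ?thesis by (rule that)
qed

section \<open>From the sign rank bound to the circuit size\<close>

lemma compose_xor_mod_fn_nonconstant:
  assumes "\<not> simple n m A"
  shows "\<nexists>t. \<forall>x\<in>cube n. \<forall>y\<in>cube n. compose_xor (mod_fn m A) x y = t"
proof
  assume "\<exists>t. \<forall>x\<in>cube n. \<forall>y\<in>cube n. compose_xor (mod_fn m A) x y = t"
  then obtain t where t: "\<And>x y. x \<in> cube n \<Longrightarrow> y \<in> cube n \<Longrightarrow> compose_xor (mod_fn m A) x y = t"
    by blast
  have "mod_fn m A x = t" if x: "x \<in> cube n" for x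
  proof -
    have n: "n = length x" using x by (simp add: cube_def)
    have "compose_xor (mod_fn m A) x (replicate n False) = mod_fn m A x"
      unfolding compose_xor_def n map2_neq_replicate_False ..
    moreover have "replicate n False \<in> cube n" by (simp add: cube_def)
    ultimately show ?thesis using t[OF x] by metis
  qed
  then have "\<forall>x\<in>cube n. mod_fn m A x = t" by blast
  with assms show False unfolding simple_def by blast
qed

text \<open>The 8 collects two factors of \<open>q\<close> cancelled by
  \<open>(real q)\<^sup>2\<close> and six factors of 2 from
  \<open>16 * (S + 1)\<^sup>2 \<le> 2 ^ 6 * S\<^sup>2\<close>. For \<open>N < 8\<close> the exponent
  is negative.\<close>

lemma powr_le_if_sign_rank_bound:
  fixes S :: real and N q :: nat
  assumes "2 \<le> S" "2 \<le> q" and bound: "real q ^ N \<le> 16 * (S + 1)\<^sup>2 * (real q)\<^sup>2"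
  shows "2 powr ((real N - 8) / 2) \<le> S"
proof (cases "N \<ge> 8")
  case True
  define M where "M = N - 8"
  have N: "N = M + 6 + 2" using True by (simp add: M_def)
  have "real q ^ (M + 6) * (real q)\<^sup>2 \<le> 16 * (S + 1)\<^sup>2 * (real q)\<^sup>2"
    using bound unfolding N power_add .
  then have "real q ^ (M + 6) \<le> 16 * (S + 1)\<^sup>2"
    by (rule mult_right_le_imp_le) (use assms(2) in simp)
  moreover have "(2::real) ^ (M + 6) \<le> real q ^ (M + 6)" using assms(2) by (intro power_mono) auto
  moreover have "(S + 1)\<^sup>2 \<le> (2 * S)\<^sup>2" using assms(1) by (intro power_mono) auto
  moreover have "(2::real) ^ (M + 6) = 64 * 2 ^ M" by (simp add: power_add)
  ultimately have "(2::real) ^ M \<le> S\<^sup>2" by (simp add: power_mult_distrib)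
  moreover have "(2 powr (real M / 2))\<^sup>2 = (2::real) ^ M"
    unfolding power2_eq_square powr_add[symmetric] field_sum_of_halves by (rule powr_realpow) simp
  ultimately have "(2 powr (real M / 2))\<^sup>2 \<le> S\<^sup>2" by simp
  then have "2 powr (real M / 2) \<le> S"
    by (intro power2_le_imp_le[of "2 powr (real M / 2)" S]) (use assms(1) in linarith)+
  then show ?thesis by (simp add: N)
next
  case False
  then have "2 powr ((real N - 8) / 2) \<le> 2 powr (0::real)" by (intro powr_mono) auto
  then show ?thesis using assms(1) by simp
qed

theorem mainTheorem11:
  "\<exists>\<delta>::real. \<delta> > 0 \<and>
    (\<forall>(m::nat) (j::nat) (k::nat) (n::nat) (A::nat set) (C::two_party set) (c::nat) (T::thr_circuit).
       m \<ge> 3 \<longrightarrow> m = j * 2 ^ k \<longrightarrow> (odd j \<and> j \<ge> 3) \<or> j = 4 \<longrightarrow> m < n \<longrightarrow>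
       A \<subseteq> {..<m} \<longrightarrow> \<not> simple n m A \<longrightarrow>
       C \<subseteq> two_party_fns n \<longrightarrow> (\<forall>f\<in>C. det_cc n f \<le> c) \<longrightarrow>
       circuit_gates T \<subseteq> C \<longrightarrow> circuit_computes n T (compose_xor (mod_fn m A)) \<longrightarrow>
       real (circuit_size T) \<ge>
         2 powr (\<delta> * ((real n - real k * real m) / (real j * real m))
                 - 2 * real j * log 2 (real j) / real m - real c))"
proof (intro exI[of _ "1 / 42"] conjI allI impI)
  fix m j k n :: nat and A :: "nat set" and C :: "two_party set" and c :: nat and T :: thr_circuit
  assume m3: "m \<ge> 3" and mj: "m = j * 2 ^ k" and j: "(odd j \<and> j \<ge> 3) \<or> j = 4" and mn: "m < n"
    and ns: "\<not> simple n m A" and CC: "\<forall>f\<in>C. det_cc n f \<le> c" "circuit_gates T \<subseteq> C"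
    and comp: "circuit_computes n T (compose_xor (mod_fn m A))"
  have cc: "det_cc n g \<le> c" if "g \<in> circuit_gates T" for g using CC that by blast
  have m0: "m > 0" using m3 by simp
  obtain q where q: "prime q" "q = 2 \<or> (odd q \<and> q dvd m)"
    and bound: "\<And>N. m + 3 * Suc N * m * q \<le> n \<Longrightarrow>
      real q ^ N \<le> 16 * (real (circuit_size T * 2 ^ c + 1))\<^sup>2 * (real q)\<^sup>2"
    by (rule circuit_size_sign_rank_bound[OF m0 ns comp cc], assumption) (rule that)
  have j3: "j \<ge> 3" using j by auto
  \<comment> \<open>An odd prime that divides \<open>j * 2 ^ k\<close> divides
    \<open>j\<close>.\<close>
  have "q \<le> j"
    using q(2)
  proof
    assume "q = 2"
    then show ?thesis using j3 by simp
  next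
    assume qm: "odd q \<and> q dvd m"
    then have "\<not> q dvd 2" using primes_dvd_imp_eq[OF q(1) two_is_prime_nat] by auto
    then have "\<not> q dvd 2 ^ k" using prime_dvd_power[OF q(1)] by blast
    moreover have "q dvd j * 2 ^ k" using qm mj by simp
    ultimately have "q dvd j" using prime_dvd_multD[OF q(1)] by blast
    then show ?thesis using j3 by (intro dvd_imp_le) auto
  qed
  define S where "S = real (circuit_size T) * 2 ^ c"
  have S2: "2 \<le> S"
  proof -
    have "2 \<le> circuit_size T * 2 ^ c"
      by (rule circuit_size_ge_2[OF comp cc compose_xor_mod_fn_nonconstant[OF ns]])
    then have "real 2 \<le> real (circuit_size T * 2 ^ c)" by (simp only: of_nat_le_iff)
    then show ?thesis by (simp add: S_def)
  qed
  define x where "x = real n / (real j * real m)"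
  have jm: "real j * real m > 0" using j3 m0 by simp
  \<comment> \<open>For \<open>x \<le> 42\<close> the left side is at most 2. Beyond that,
    \<open>x < 3 * L + 4\<close> and \<open>N = L - 1\<close> give
    \<open>(N - 8) / 2 > (x - 31) / 6 \<ge> x / 42\<close>.\<close>
  have "2 powr (x / 42) \<le> S"
  proof (cases "x \<le> 42")
    case True
    then have "2 powr (x / 42) \<le> 2 powr (1::real)" by (intro powr_mono) auto
    then show ?thesis using S2 by simp
  next
    case False
    \<comment> \<open>The offset reserves \<open>m\<close> bits, and each coordinate gets
      \<open>3 * m * j\<close> bits, which is enough because \<open>q \<le> j\<close>.\<close>
    define L where "L = (n - m) div (3 * m * j)"
    have jm0: "3 * m * j > 0" using j3 m0 by simp
    have "n - m < Suc L * (3 * m * j)"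
      using dividend_less_div_times[OF jm0, of "n - m"] by (simp add: L_def)
    then have "real (n - m) < real (Suc L * (3 * m * j))" by (simp only: of_nat_less_iff)
    then have "real n < real m + (real L + 1) * (3 * (real j * real m))"
      using mn by (simp add: of_nat_diff algebra_simps)
    moreover have "real m \<le> real j * real m" using mult_right_mono[of 1 "real j" "real m"] j3 by simp
    ultimately have "real n < (3 * real L + 4) * (real j * real m)" by (simp add: algebra_simps)
    then have xL: "x < 3 * real L + 4" using jm by (simp add: x_def pos_divide_less_eq)
    with False obtain N where N: "L = Suc N" by (cases L) auto
    have "3 * Suc N * m * q \<le> L * (3 * m * j)"
      using mult_le_mono2[OF \<open>q \<le> j\<close>, of "3 * Suc N * m"] by (simp only: N mult_ac)
    also have "\<dots> \<le> n - m" unfolding L_def by (rule div_times_less_eq_dividend)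
    finally have "m + 3 * Suc N * m * q \<le> n" using mn by simp
    from bound[OF this] have "real q ^ N \<le> 16 * (S + 1)\<^sup>2 * (real q)\<^sup>2" by (simp add: S_def add.commute)
    then have "2 powr ((real N - 8) / 2) \<le> S"
      using powr_le_if_sign_rank_bound[OF S2 prime_ge_2_nat[OF q(1)]] by blast
    moreover have "2 powr (x / 42) \<le> 2 powr ((real N - 8) / 2)"
      using xL False N by (intro powr_mono) auto
    ultimately show ?thesis by (rule order_trans[rotated])
  qed
  then have "2 powr (x / 42 - real c) \<le> real (circuit_size T)"
    by (simp add: S_def powr_diff powr_realpow divide_le_eq)
  \<comment> \<open>The terms with \<open>k * m\<close> and \<open>log 2 j\<close> only lower the
    exponent.\<close>
  moreover have "1 / 42 * ((real n - real k * real m) / (real j * real m))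
      - 2 * real j * log 2 (real j) / real m - real c \<le> x / 42 - real c"
  proof -
    have "(real n - real k * real m) / (real j * real m) \<le> x"
      unfolding x_def using jm by (intro divide_right_mono) auto
    moreover have "0 \<le> 2 * real j * log 2 (real j) / real m" using j3 by simp
    ultimately show ?thesis by linarith
  qed
  ultimately show "2 powr (1 / 42 * ((real n - real k * real m) / (real j * real m))
      - 2 * real j * log 2 (real j) / real m - real c) \<le> real (circuit_size T)"
    by (elim order_trans[rotated]) (intro powr_mono; simp)
qed simp

end
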